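(* Let $\mathtt{X}\in\{\mathtt{RT},\mathtt{FT},\mathtt{R},\mathtt{F}\}$, with $\mathcal{E}_{\mathtt{RT}}=\mathcal{E}_1\cup\{\mathrm{RT},\mathrm{FP},\mathrm{EL2}\}$, $\mathcal{E}_{\mathtt{FT}}=\mathcal{E}_1\cup\{\mathrm{FT},\mathrm{RS},\mathrm{FP},\mathrm{EL2}\}$, $\mathcal{E}_{\mathtt{R}}=\mathcal{E}_1\cup\{\mathrm{R},\mathrm{FP},\mathrm{EL2}\}$, $\mathcal{E}_{\mathtt{F}}=\mathcal{E}_1\cup\{\mathrm{F},\mathrm{R},\mathrm{FP},\mathrm{EL2}\}$. Then for all closed $\mathrm{BCCSP}_{\|}$ terms $p,q$: $p\sim_{\mathtt{X}} q$ if and only if $\mathcal{E}_{\mathtt{X}}\vdash p\approx q$.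
   Context: Let $\mathcal{A}$ be a finite non-empty set of actions and $\mathcal{V}$ a countably infinite set of variables. $\mathrm{BCCSP}_{\|}$ terms: $t ::= \mathbf{0} \mid x \mid a.t \mid t+t \mid t \,\|\, t$ ($a\in\mathcal{A}$, $x\in\mathcal{V}$; $ax$ means $a.x$). Closed terms are processes. Transitions: $a.p \xrightarrow{a} p$; if $p \xrightarrow{a} p'$ then $p+q \xrightarrow{a} p'$, $q+p \xrightarrow{a} p'$, $p\|q \xrightarrow{a} p'\|q$, $q \| p \xrightarrow{a} q \| p'$. $\mathtt{I}(p)=\{a\mid \exists p'.\,p\xrightarrow{a}p'\}$; $p\xrightarrow{\alpha}p'$ for $\alpha=a_1\cdots a_n\in\mathcal{A}^*$ means $p=p_0\xrightarrow{a_1}p_1\cdots\xrightarrow{a_n}p_n=p'$. Failure pairs: $\mathtt{F}(p)=\{(\alpha,X)\mid X\subseteq\mathcal{A},\ p\xrightarrow{\alpha}q,\ \mathtt{I}(q)\cap X=\emptyset\}$; ready pairs: $\mathtt{R}(p)=\{(\alpha,X)\mid p\xrightarrow{\alpha}q,\ \mathtt{I}(q)=X\}$. A failure trace of $p$ is $X_0a_1X_1\cdots a_nX_n$ such that $p=p_0\xrightarrow{a_1}p_1\cdots\xrightarrow{a_n}p_n$ with $\mathtt{I}(p_i)\cap X_i=\emptyset$ for all $i$; a ready trace is the same with $\mathtt{I}(p_i)=X_i$. $p\sim_{\mathtt{F}}q$, $p\sim_{\mathtt{R}}q$, $p\sim_{\mathtt{FT}}q$, $p\sim_{\mathtt{RT}}q$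 iff $p,q$ have the same failure pairs, ready pairs, failure traces, ready traces respectively. $\mathcal{E}\vdash t\approx u$: derivable in equational logic (reflexivity, symmetry, transitivity, substitution instances of axioms, closure under $a.\_$, $+$, $\|$). Axioms with concrete action names stand for all instances with actions from $\mathcal{A}$; $\sum_{i\in I}$ denotes finite sums ($\mathbf{0}$ if empty). $\mathcal{E}_1$: A0 $x+\mathbf{0}\approx x$; A1 $x+y\approx y+x$; A2 $(x+y)+z \approx x+(y+z)$; A3 $x+x\approx x$; P0 $x\|\mathbf{0}\approx x$; P1 $x\|y \approx y \| x$. RT: $a(\sum_{i=1}^{|\mathcal{A}|}(b_ix_i+b_iy_i)+z)\approx a(\sum_{i=1}^{|\mathcal{A}|}b_ix_i+z)+a(\sum_{i=1}^{|\mathcal{A}|}b_iy_i+z)$ for all $a,b_1,\dots,b_{|\mathcal{A}|}\in\mathcal{A}$. FP: $(ax+ay+w)\|z\approx(ax+w)\|z+(ay+w)\|z$. FT: $ax+ay\approx ax+ay+a(x+y)$. RS: $a(bx+by+z)\approx a(bx+by+z)+a(bx+z)$. R: $a(bx+z)+a(by+w)\approx a(bx+by+z)+a(by+w)$. F: $ax+a(y+z)\approx ax+a(x+y)+a(y+z)$. EL2: $\sum_{i\in I} a_ix_i \| \sum_{j\in J} b_jy_j \approx \sum_{i\in I} a_i(x_i \| \sum_{j\in J} b_j y_j) + \sum_{j\in J} b_j(\sum_{i\in I} a_i x_i \| y_j)$ for finite $I,J$ with the $a_i$ pairwise distinct and the $b_j$ pairwise distinct. *)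

theory Defs
  imports Main
begin

text \<open>
  The action type \<open>'a\<close> is the set of actions; it is required to be of class \<open>finite\<close> wherever
  finiteness matters, and is non-empty because every type is. Variables are natural numbers.
\<close>

datatype 'a pterm =
    Zero
  | Var nat
  | Act 'a "'a pterm"
  | Plus "'a pterm" "'a pterm" (infixl "[+]" 65)
  | Par "'a pterm" "'a pterm" (infixl "[||]" 70)

primrec vars :: "'a pterm \<Rightarrow> nat set" where
  "vars Zero = {}"
| "vars (Var v) = {v}"
| "vars (Act a t) = vars t"
| "vars (t [+] u) = vars t \<union> vars u"
| "vars (t [||] u) = vars t \<union> vars u"

definition closed_term :: "'a pterm \<Rightarrow> bool" where
  "closed_term t \<longleftrightarrow> vars t = {}"

primrec psubst :: "(nat \<Rightarrow> 'a pterm) \<Rightarrow> 'a pterm \<Rightarrow> 'a pterm" where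
  "psubst \<sigma> Zero = Zero"
| "psubst \<sigma> (Var v) = \<sigma> v"
| "psubst \<sigma> (Act a t) = Act a (psubst \<sigma> t)"
| "psubst \<sigma> (t [+] u) = psubst \<sigma> t [+] psubst \<sigma> u"
| "psubst \<sigma> (t [||] u) = psubst \<sigma> t [||] psubst \<sigma> u"


subsection \<open>Operational semantics and the four equivalences\<close>

inductive transition :: "'a pterm \<Rightarrow> 'a \<Rightarrow> 'a pterm \<Rightarrow> bool" where
  trans_act: "transition (Act a p) a p"
| trans_plusL: "transition p a p' \<Longrightarrow> transition (p [+] q) a p'"
| trans_plusR: "transition p a p' \<Longrightarrow> transition (q [+] p) a p'"
| trans_parL: "transition p a p' \<Longrightarrow> transition (p [||] q) a (p' [||] q)"
| trans_parR: "transition p a p' \<Longrightarrow> transition (q [||] p) a (q [||] p')"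

definition initials :: "'a pterm \<Rightarrow> 'a set" where
  "initials p = {a. \<exists>p'. transition p a p'}"

inductive steps :: "'a pterm \<Rightarrow> 'a list \<Rightarrow> 'a pterm \<Rightarrow> bool" where
  steps_Nil: "steps p [] p"
| steps_Cons: "transition p a p' \<Longrightarrow> steps p' \<alpha> q \<Longrightarrow> steps p (a # \<alpha>) q"

definition failure_pairs :: "'a pterm \<Rightarrow> ('a list \<times> 'a set) set" where
  "failure_pairs p = {(\<alpha>, X). \<exists>q. steps p \<alpha> q \<and> initials q \<inter> X = {}}"

definition ready_pairs :: "'a pterm \<Rightarrow> ('a list \<times> 'a set) set" where
  "ready_pairs p = {(\<alpha>, X). \<exists>q. steps p \<alpha> q \<and> initials q = X}"

text \<open>
  The list \<open>[p\<^sub>0, \<dots>, p\<^sub>n]\<close> is a run of \<open>p = p\<^sub>0\<close> along \<open>[a\<^sub>1, \<dots>, a\<^sub>n]\<close>. Since list positions start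
  at 0, \<open>\<alpha> ! i\<close> is the action \<open>a\<^sub>i\<^sub>+\<^sub>1\<close> leading from \<open>p\<^sub>i\<close> to \<open>p\<^sub>i\<^sub>+\<^sub>1\<close>.
\<close>

definition is_run :: "'a pterm \<Rightarrow> 'a list \<Rightarrow> 'a pterm list \<Rightarrow> bool" where
  "is_run p \<alpha> ps \<longleftrightarrow>
     length ps = Suc (length \<alpha>) \<and> ps ! 0 = p \<and>
     (\<forall>i < length \<alpha>. transition (ps ! i) (\<alpha> ! i) (ps ! Suc i))"

text \<open>
  A failure or ready trace \<open>X\<^sub>0 a\<^sub>1 X\<^sub>1 \<dots> a\<^sub>n X\<^sub>n\<close> is represented by the pair of
  \<open>[a\<^sub>1, \<dots>, a\<^sub>n]\<close> and \<open>[X\<^sub>0, \<dots>, X\<^sub>n]\<close>.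
\<close>

definition failure_traces :: "'a pterm \<Rightarrow> ('a list \<times> 'a set list) set" where
  "failure_traces p = {(\<alpha>, Xs). length Xs = Suc (length \<alpha>) \<and>
     (\<exists>ps. is_run p \<alpha> ps \<and> (\<forall>i \<le> length \<alpha>. initials (ps ! i) \<inter> Xs ! i = {}))}"

definition ready_traces :: "'a pterm \<Rightarrow> ('a list \<times> 'a set list) set" where
  "ready_traces p = {(\<alpha>, Xs). length Xs = Suc (length \<alpha>) \<and>
     (\<exists>ps. is_run p \<alpha> ps \<and> (\<forall>i \<le> length \<alpha>. initials (ps ! i) = Xs ! i))}"

datatype semantics = Ready_Trace | Failure_Trace | Readiness | Failures

primrec sem_equiv :: "semantics \<Rightarrow> 'a pterm \<Rightarrow> 'a pterm \<Rightarrow> bool" where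
  "sem_equiv Ready_Trace p q \<longleftrightarrow> ready_traces p = ready_traces q"
| "sem_equiv Failure_Trace p q \<longleftrightarrow> failure_traces p = failure_traces q"
| "sem_equiv Readiness p q \<longleftrightarrow> ready_pairs p = ready_pairs q"
| "sem_equiv Failures p q \<longleftrightarrow> failure_pairs p = failure_pairs q"


subsection \<open>Equational logic\<close>

inductive derivable :: "('a pterm \<times> 'a pterm) set \<Rightarrow> 'a pterm \<Rightarrow> 'a pterm \<Rightarrow> bool"
    ("_ \<turnstile> _ \<approx> _" [51, 51, 51] 50)
  for E :: "('a pterm \<times> 'a pterm) set" where
  drv_refl: "E \<turnstile> t \<approx> t"
| drv_sym: "E \<turnstile> t \<approx> u \<Longrightarrow> E \<turnstile> u \<approx> t"
| drv_trans: "E \<turnstile> t \<approx> u \<Longrightarrow> E \<turnstile> u \<approx> v \<Longrightarrow> E \<turnstile> t \<approx> v"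
| drv_axiom: "(t, u) \<in> E \<Longrightarrow> E \<turnstile> psubst \<sigma> t \<approx> psubst \<sigma> u"
| drv_act: "E \<turnstile> t \<approx> u \<Longrightarrow> E \<turnstile> Act a t \<approx> Act a u"
| drv_plus: "E \<turnstile> t \<approx> u \<Longrightarrow> E \<turnstile> t' \<approx> u' \<Longrightarrow> E \<turnstile> t [+] t' \<approx> u [+] u'"
| drv_par: "E \<turnstile> t \<approx> u \<Longrightarrow> E \<turnstile> t' \<approx> u' \<Longrightarrow> E \<turnstile> t [||] t' \<approx> u [||] u'"


subsection \<open>Axioms\<close>

text \<open>
  A finite sum is taken over a list of summands and bracketed to the right; the empty sum is
  \<open>Zero\<close>, and non-empty sums contain no spurious \<open>Zero\<close>.
\<close>

fun psum :: "'a pterm list \<Rightarrow> 'a pterm" where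
  "psum [] = Zero"
| "psum [t] = t"
| "psum (t # u # ts) = t [+] psum (u # ts)"

abbreviation (input) vx :: "'a pterm" where "vx \<equiv> Var 0"
abbreviation (input) vy :: "'a pterm" where "vy \<equiv> Var 1"
abbreviation (input) vz :: "'a pterm" where "vz \<equiv> Var 2"
abbreviation (input) vw :: "'a pterm" where "vw \<equiv> Var 3"

definition ax_E1 :: "('a pterm \<times> 'a pterm) set" where
  "ax_E1 =
    {(vx [+] Zero, vx),
     (vx [+] vy, vy [+] vx),
     ((vx [+] vy) [+] vz, vx [+] (vy [+] vz)),
     (vx [+] vx, vx),
     (vx [||] Zero, vx),
     (vx [||] vy, vy [||] vx)}"

text \<open>
  In the two axiom schemes with indexed variables, \<open>x\<^sub>i\<close> and \<open>y\<^sub>i\<close> are \<open>vxs i\<close> and \<open>vys i\<close>; these are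
  pairwise distinct and avoid \<open>Var 0\<close>, which plays the role of \<open>z\<close> in \<open>ax_RT\<close>. Indices start at 0.
\<close>

abbreviation (input) vxs :: "nat \<Rightarrow> 'a pterm" where "vxs i \<equiv> Var (2 * i + 1)"
abbreviation (input) vys :: "nat \<Rightarrow> 'a pterm" where "vys i \<equiv> Var (2 * i + 2)"

definition ax_RT :: "('a::finite pterm \<times> 'a pterm) set" where
  "ax_RT =
    {(Act a (psum (map (\<lambda>i. Act (b i) (vxs i) [+] Act (b i) (vys i)) [0..<card (UNIV :: 'a set)]) [+] Var 0),
      Act a (psum (map (\<lambda>i. Act (b i) (vxs i)) [0..<card (UNIV :: 'a set)]) [+] Var 0) [+]
      Act a (psum (map (\<lambda>i. Act (b i) (vys i)) [0..<card (UNIV :: 'a set)]) [+] Var 0))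
     | (a :: 'a) (b :: nat \<Rightarrow> 'a). True}"

definition ax_FP :: "('a pterm \<times> 'a pterm) set" where
  "ax_FP =
    {((Act a vx [+] Act a vy [+] vw) [||] vz,
      (Act a vx [+] vw) [||] vz [+] (Act a vy [+] vw) [||] vz)
     | a. True}"

definition ax_FT :: "('a pterm \<times> 'a pterm) set" where
  "ax_FT =
    {(Act a vx [+] Act a vy, Act a vx [+] Act a vy [+] Act a (vx [+] vy)) | a. True}"

definition ax_RS :: "('a pterm \<times> 'a pterm) set" where
  "ax_RS =
    {(Act a (Act b vx [+] Act b vy [+] vz),
      Act a (Act b vx [+] Act b vy [+] vz) [+] Act a (Act b vx [+] vz))
     | a b. True}"

definition ax_R :: "('a pterm \<times> 'a pterm) set" where
  "ax_R =
    {(Act a (Act b vx [+] vz) [+] Act a (Act b vy [+] vw),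
      Act a (Act b vx [+] Act b vy [+] vz) [+] Act a (Act b vy [+] vw))
     | a b. True}"

definition ax_F :: "('a pterm \<times> 'a pterm) set" where
  "ax_F =
    {(Act a vx [+] Act a (vy [+] vz),
      Act a vx [+] Act a (vx [+] vy) [+] Act a (vy [+] vz))
     | a. True}"

definition ax_EL2 :: "('a pterm \<times> 'a pterm) set" where
  "ax_EL2 =
    {(let P = psum (map (\<lambda>i. Act (as ! i) (vxs i)) [0..<length as]);
          Q = psum (map (\<lambda>j. Act (bs ! j) (vys j)) [0..<length bs])
      in (P [||] Q,
          psum (map (\<lambda>i. Act (as ! i) (vxs i [||] Q)) [0..<length as]) [+]
          psum (map (\<lambda>j. Act (bs ! j) (P [||] vys j)) [0..<length bs])))
     | as bs. distinct as \<and> distinct bs}"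

primrec axioms_of :: "semantics \<Rightarrow> ('a::finite pterm \<times> 'a pterm) set" where
  "axioms_of Ready_Trace = ax_E1 \<union> ax_RT \<union> ax_FP \<union> ax_EL2"
| "axioms_of Failure_Trace = ax_E1 \<union> ax_FT \<union> ax_RS \<union> ax_FP \<union> ax_EL2"
| "axioms_of Readiness = ax_E1 \<union> ax_R \<union> ax_FP \<union> ax_EL2"
| "axioms_of Failures = ax_E1 \<union> ax_F \<union> ax_R \<union> ax_FP \<union> ax_EL2"

end

(*
  All four equivalences have the same shape: q simulates p if every ready trace of p is matched by
  a run of q whose initials are related to the prescribed sets by a relation M at intermediate
  states and by a relation E at the end. It suffices that M and E are preorders compatible with
  unions and that E is contained in M and in inclusion.

  Completeness: FP splits a parallel component until its initial actions are distinct, and then EL2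
  removes the parallel operator. On the remaining terms, call t absorbed by u if u + t = u is
  derivable. Equivalent terms absorb each other once every prefix a.p whose ready traces are all
  matched by a-derivatives of q is absorbed by q. For this the axioms are only needed in two forms:
  a.(p + q) absorbs a.p if q has no initials outside those of p, and a.p + a.q absorbs a.(p + q'),
  where q' consists of the summands of q with initials in B, provided E holds between the initials
  of p and B, and M between those of q and B.
*)
theory Submission
  imports Defs
begin

section \<open>Observations along runs\<close>

text \<open>
  \<open>M\<close> relates the initials of the states passed on the way, \<open>E\<close> those of the last state, to the
  sets in the observation. Failure observations are stated with the complements of the refused
  sets, so that the required relation is \<open>\<subseteq>\<close> rather than disjointness.
\<close>

fun obs :: "('a set \<Rightarrow> 'a set \<Rightarrow> bool) \<Rightarrow> ('a set \<Rightarrow> 'a set \<Rightarrow> bool) \<Rightarrow>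
    'a pterm \<Rightarrow> ('a \<times> 'a set) list \<Rightarrow> 'a set \<Rightarrow> bool" where
  "obs M E p [] Y \<longleftrightarrow> E (initials p) Y"
| "obs M E p ((a, X) # s) Y \<longleftrightarrow>
     M (initials p) X \<and> (\<exists>p'. transition p a p' \<and> obs M E p' s Y)"

abbreviation ready :: "'a pterm \<Rightarrow> ('a \<times> 'a set) list \<Rightarrow> 'a set \<Rightarrow> bool" where
  "ready \<equiv> obs (=) (=)"

inductive_simps steps_simps:
  "steps p [] q"
  "steps p (a # \<alpha>) q"

inductive_simps transition_simps [simp]:
  "transition Zero a t"
  "transition (Var v) a t"
  "transition (Act b p) a t"
  "transition (p [+] q) a t"
  "transition (p [||] q) a t"

lemma initials_simps [simp]:
  "initials Zero = {}"
  "initials (Var v) = {}"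
  "initials (Act a p) = {a}"
  "initials (p [+] q) = initials p \<union> initials q"
  "initials (p [||] q) = initials p \<union> initials q"
  by (auto simp: initials_def)

lemma transition_psum:
  "transition (psum ts) a t' \<longleftrightarrow> (\<exists>t\<in>set ts. transition t a t')"
  by (induction ts rule: psum.induct) auto

lemma initials_psum: "initials (psum ts) = (\<Union>t\<in>set ts. initials t)"
  by (auto simp: initials_def transition_psum)

lemma is_run_Nil: "is_run p [] ps \<longleftrightarrow> ps = [p]"
  by (auto simp: is_run_def length_Suc_conv)

lemma is_run_Cons:
  "is_run p (a # \<alpha>) ps \<longleftrightarrow> (\<exists>p' ps'. ps = p # ps' \<and> transition p a p' \<and> is_run p' \<alpha> ps')"
proof (cases ps)
  case (Cons p0 ps')
  have "is_run p (a # \<alpha>) ps \<longleftrightarrow> length ps' = Suc (length \<alpha>) \<and> p0 = p \<and>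
      transition p0 a (ps' ! 0) \<and> (\<forall>i < length \<alpha>. transition (ps' ! i) (\<alpha> ! i) (ps' ! Suc i))"
    unfolding is_run_def Cons by (simp add: All_less_Suc2)
  then show ?thesis
    unfolding Cons is_run_def by auto
qed (simp add: is_run_def)

text \<open>A run visits one state more than it has actions: \<open>zip\<close> pairs each action
  with the set at its source and truncates the last set, which becomes the end observation.\<close>

lemma obs_iff_run:
  assumes "length Xs = Suc (length \<alpha>)"
  shows "obs R R p (zip \<alpha> Xs) (last Xs) \<longleftrightarrow>
    (\<exists>ps. is_run p \<alpha> ps \<and> (\<forall>i \<le> length \<alpha>. R (initials (ps ! i)) (Xs ! i)))"
  using assms
proof (induction \<alpha> arbitrary: p Xs)
  case Nil
  then show ?case by (auto simp: is_run_Nil length_Suc_conv)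
next
  case (Cons a \<alpha>)
  then obtain X Xs' where Xs: "Xs = X # Xs'" "length Xs' = Suc (length \<alpha>)"
    by (auto simp: length_Suc_conv)
  have split: "(\<forall>i \<le> length (a # \<alpha>). P i) \<longleftrightarrow> P 0 \<and> (\<forall>i \<le> length \<alpha>. P (Suc i))" for P
    by (simp add: All_less_Suc2 flip: less_Suc_eq_le)
  have "obs R R p (zip (a # \<alpha>) Xs) (last Xs) \<longleftrightarrow>
      R (initials p) X \<and> (\<exists>p'. transition p a p' \<and> obs R R p' (zip \<alpha> Xs') (last Xs'))"
    using Xs by auto
  moreover have "(\<exists>ps. is_run p (a # \<alpha>) ps \<and> Q ps) \<longleftrightarrow>
      (\<exists>p' ps'. transition p a p' \<and> is_run p' \<alpha> ps' \<and> Q (p # ps'))" for Q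
    unfolding is_run_Cons by blast
  ultimately show ?case
    unfolding Cons.IH[OF Xs(2)] split Xs(1) by (simp only: nth_Cons_0 nth_Cons_Suc) blast
qed

lemma obs_iff_steps:
  "obs (\<lambda>_ _. True) E p s Y \<longleftrightarrow> (\<exists>q. steps p (map fst s) q \<and> E (initials q) Y)"
proof (induction s arbitrary: p)
  case Nil
  then show ?case by (simp add: steps_simps)
next
  case (Cons x s)
  then show ?case
    by (cases x) (auto simp: steps_simps)
qed

text \<open>Pair semantics look only at the last state of a run, hence the trivial relation on the
  way.\<close>

primrec mid_rel :: "semantics \<Rightarrow> 'a set \<Rightarrow> 'a set \<Rightarrow> bool" where
  "mid_rel Ready_Trace = (=)"
| "mid_rel Failure_Trace = (\<subseteq>)"
| "mid_rel Readiness = (\<lambda>_ _. True)"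
| "mid_rel Failures = (\<lambda>_ _. True)"

primrec end_rel :: "semantics \<Rightarrow> 'a set \<Rightarrow> 'a set \<Rightarrow> bool" where
  "end_rel Ready_Trace = (=)"
| "end_rel Failure_Trace = (\<subseteq>)"
| "end_rel Readiness = (=)"
| "end_rel Failures = (\<subseteq>)"

lemma trace_sets_eq_iff_obs:
  "{(\<alpha>, Xs). length Xs = Suc (length \<alpha>) \<and>
     (\<exists>ps. is_run p \<alpha> ps \<and> (\<forall>i \<le> length \<alpha>. R (initials (ps ! i)) (Xs ! i)))} =
   {(\<alpha>, Xs). length Xs = Suc (length \<alpha>) \<and>
     (\<exists>ps. is_run q \<alpha> ps \<and> (\<forall>i \<le> length \<alpha>. R (initials (ps ! i)) (Xs ! i)))} \<longleftrightarrow>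
   obs R R p = obs R R (q :: 'a pterm)" (is "?A p = ?A q \<longleftrightarrow> _")
proof -
  have A: "?A r = {(\<alpha>, Xs). length Xs = Suc (length \<alpha>) \<and> obs R R r (zip \<alpha> Xs) (last Xs)}" for r
    using obs_iff_run[of _ _ R r] by blast
  show ?thesis
  proof
    assume eq: "?A p = ?A q"
    show "obs R R p = obs R R q"
    proof (intro ext)
      fix s :: "('a \<times> 'a set) list" and Y
      \<comment> \<open>Every \<open>(s, Y)\<close> arises from lists with one more set than
        actions, so no observation is lost.\<close>
      have z: "zip (map fst s) (map snd s @ [Y]) = s" by (induction s) auto
      have "(map fst s, map snd s @ [Y]) \<in> ?A p \<longleftrightarrow> (map fst s, map snd s @ [Y]) \<in> ?A q"
        using eq by simp
      then show "obs R R p s Y = obs R R q s Y"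
        unfolding A by (simp add: z)
    qed
  qed (simp add: A)
qed

text \<open>Complementing every set is an involution on observations that exchanges disjointness and
  inclusion, so equality transfers in both directions.\<close>

lemma failure_traces_eq_iff:
  fixes p q :: "'a pterm"
  shows "failure_traces p = failure_traces q \<longleftrightarrow> obs (\<subseteq>) (\<subseteq>) p = obs (\<subseteq>) (\<subseteq>) q"
proof -
  let ?D = "\<lambda>I X. I \<inter> X = {}"
  have 1: "obs ?D ?D r s Y = obs (\<subseteq>) (\<subseteq>) r (map (map_prod id uminus) s) (- Y)" for r :: "'a pterm" and s Y
    by (induction s arbitrary: r) (auto simp: disjoint_eq_subset_Compl)
  have inv: "map (map_prod id uminus) (map (map_prod id uminus) s) = s" for s :: "('a \<times> 'a set) list"
    by (induction s) auto
  have 2: "obs (\<subseteq>) (\<subseteq>) r s Y = obs ?D ?D r (map (map_prod id uminus) s) (- Y)" for r :: "'a pterm" and s Y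
    unfolding 1 inv by simp
  have "obs ?D ?D p = obs ?D ?D q \<longleftrightarrow> obs (\<subseteq>) (\<subseteq>) p = obs (\<subseteq>) (\<subseteq>) q"
    unfolding fun_eq_iff using 1 2 by metis
  then show ?thesis
    unfolding failure_traces_def trace_sets_eq_iff_obs[where R = ?D] .
qed

lemma pair_sets_eq_iff_obs:
  "{(\<alpha>, X). \<exists>q. steps p \<alpha> q \<and> E (initials q) X} = {(\<alpha>, X). \<exists>q. steps r \<alpha> q \<and> E (initials q) X}
    \<longleftrightarrow> obs (\<lambda>_ _. True) E p = obs (\<lambda>_ _. True) E r" (is "?A p = ?A r \<longleftrightarrow> _")
proof -
  \<comment> \<open>The sets on the way are unconstrained, so \<open>{}\<close> serves as a
    filler.\<close>
  have A: "(\<alpha>, X) \<in> ?A r \<longleftrightarrow> obs (\<lambda>_ _. True) E r (map (\<lambda>a. (a, {})) \<alpha>) X" for r \<alpha> X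
    by (simp add: obs_iff_steps comp_def)
  show ?thesis
  proof
    assume "?A p = ?A r"
    then have "(map fst s, X) \<in> ?A p \<longleftrightarrow> (map fst s, X) \<in> ?A r" for s :: "('a \<times> 'a set) list" and X
      by simp
    then show "obs (\<lambda>_ _. True) E p = obs (\<lambda>_ _. True) E r"
      by (intro ext) (simp add: obs_iff_steps)
  next
    assume "obs (\<lambda>_ _. True) E p = obs (\<lambda>_ _. True) E r"
    then have "x \<in> ?A p \<longleftrightarrow> x \<in> ?A r" for x
      by (cases x) (simp only: A)
    then show "?A p = ?A r" by blast
  qed
qed

lemma failure_pairs_eq_iff:
  "failure_pairs p = failure_pairs q \<longleftrightarrow>
    obs (\<lambda>_ _. True) (\<subseteq>) p = obs (\<lambda>_ _. True) (\<subseteq>) q"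
proof -
  let ?D = "\<lambda>I X. I \<inter> X = {}"
  have "obs (\<lambda>_ _. True) ?D r s Y = obs (\<lambda>_ _. True) (\<subseteq>) r s (- Y)" for r :: "'a pterm" and s Y
    by (simp add: obs_iff_steps disjoint_eq_subset_Compl)
  then have "obs (\<lambda>_ _. True) ?D p = obs (\<lambda>_ _. True) ?D q \<longleftrightarrow>
      obs (\<lambda>_ _. True) (\<subseteq>) p = obs (\<lambda>_ _. True) (\<subseteq>) q"
    by (simp add: fun_eq_iff) (metis double_complement)
  then show ?thesis
    unfolding failure_pairs_def pair_sets_eq_iff_obs[where E = ?D] .
qed

lemma sem_equiv_iff_obs:
  "sem_equiv X p q \<longleftrightarrow> obs (mid_rel X) (end_rel X) p = obs (mid_rel X) (end_rel X) q"
  by (cases X) (simp_all add: failure_traces_eq_iff failure_pairs_eq_iff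
      ready_traces_def trace_sets_eq_iff_obs ready_pairs_def pair_sets_eq_iff_obs)


section \<open>Soundness\<close>

text \<open>Transitivity makes the exact ready trace of a run at least as informative as any other
  observation of it, compatibility with unions gives congruence for \<open>[+]\<close> and
  \<open>[||]\<close>, and \<open>E_subset\<close> serves completeness.\<close>

locale observation =
  fixes M E :: "'a set \<Rightarrow> 'a set \<Rightarrow> bool"
  assumes E_refl: "E A A"
    and E_imp_M: "E A B \<Longrightarrow> M A B"
    and M_trans: "M A B \<Longrightarrow> M B C \<Longrightarrow> M A C"
    and E_trans: "E A B \<Longrightarrow> E B C \<Longrightarrow> E A C"
    and M_Un: "M A B \<Longrightarrow> M (A \<union> C) (B \<union> C)"
    and E_Un: "E A B \<Longrightarrow> E (A \<union> C) (B \<union> C)"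
    and E_subset: "E A B \<Longrightarrow> A \<subseteq> B"
begin

lemma M_refl: "M A A"
  using E_refl E_imp_M by blast

text \<open>Only ready traces of \<open>p\<close> are tested, so that the sets along a run of
  \<open>p\<close> are known exactly. By \<open>le_iff\<close> this is still inclusion of all
  observations, hence transitive.\<close>

definition le :: "'a pterm \<Rightarrow> 'a pterm \<Rightarrow> bool" where
  "le p q \<longleftrightarrow> (\<forall>s Y. ready p s Y \<longrightarrow> obs M E q s Y)"

lemma ready_imp_obs: "ready p s Y \<Longrightarrow> obs M E p s Y"
proof (induction s arbitrary: p)
  case (Cons x s)
  then show ?case by (cases x) (auto simp: M_refl)
qed (simp add: E_refl)

text \<open>The ready trace records the actual initials along the witnessing run; transitivity of
  \<open>M\<close> and \<open>E\<close> then leads from these to the prescribed sets.\<close>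

lemma obs_imp_ready:
  "obs M E p s Y \<Longrightarrow> \<exists>s' Y'. ready p s' Y' \<and> (\<forall>q. obs M E q s' Y' \<longrightarrow> obs M E q s Y)"
proof (induction s arbitrary: p)
  case Nil
  then have "ready p [] (initials p) \<and> (\<forall>q. obs M E q [] (initials p) \<longrightarrow> obs M E q [] Y)"
    using E_trans by auto
  then show ?case by blast
next
  case (Cons x s)
  obtain a X where x: "x = (a, X)" by fastforce
  obtain p' where p': "M (initials p) X" "transition p a p'" "obs M E p' s Y"
    using Cons.prems x by auto
  obtain s' Y' where s': "ready p' s' Y'" "\<And>q. obs M E q s' Y' \<Longrightarrow> obs M E q s Y"
    using Cons.IH p'(3) by blast
  have "ready p ((a, initials p) # s') Y'"
    using p' s' by auto
  moreover have "obs M E q (x # s) Y" if "obs M E q ((a, initials p) # s') Y'" for q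
    using that x s'(2) p'(1) M_trans by auto
  ultimately show ?case by blast
qed

lemma le_iff: "le p q \<longleftrightarrow> (\<forall>s Y. obs M E p s Y \<longrightarrow> obs M E q s Y)"
  unfolding le_def using ready_imp_obs obs_imp_ready by blast

lemma le_refl: "le p p"
  by (simp add: le_iff)

lemma le_trans: "le p q \<Longrightarrow> le q r \<Longrightarrow> le p r"
  by (simp add: le_iff)

lemma obs_eq_iff_le: "obs M E p = obs M E q \<longleftrightarrow> le p q \<and> le q p"
  by (auto simp: le_iff fun_eq_iff)

lemma ready_subset_le: "(\<And>s Y. ready p s Y \<Longrightarrow> ready q s Y) \<Longrightarrow> le p q"
  by (simp add: le_def ready_imp_obs)

lemma le_initials: assumes "le p q" shows "E (initials q) (initials p)"
  using assms unfolding le_def by (metis obs.simps(1))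

text \<open>Needed for parallel composition: when the other component moves first, \<open>p\<close>
  stays in place, and its initials must already be related whatever trace it follows later.\<close>

lemma obs_ready_initials:
  assumes "ready p s Y" "obs M E q s Y" shows "M (initials q) (initials p)"
  using assms by (cases s) (auto simp: E_imp_M)

lemma leI:
  assumes "E (initials q) (initials p)"
    and "\<And>a p' s Y. transition p a p' \<Longrightarrow> ready p' s Y \<Longrightarrow> \<exists>q'. transition q a q' \<and> obs M E q' s Y"
  shows "le p q"
  unfolding le_def
proof (intro allI impI)
  fix s Y
  assume "ready p s Y"
  then show "obs M E q s Y"
    using assms by (cases s) (auto simp: E_imp_M)
qed

lemma leD:
  assumes "le p q" "transition p a p'" "ready p' s Y"
  shows "\<exists>q'. transition q a q' \<and> obs M E q' s Y"
proof -
  have "ready p ((a, initials p) # s) Y" using assms by auto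
  then have "obs M E q ((a, initials p) # s) Y" using assms(1) unfolding le_def by blast
  then show ?thesis by auto
qed

section \<open>Congruence properties of the preorder\<close>

lemma le_Act: "le p q \<Longrightarrow> le (Act a p) (Act a q)"
  by (rule leI) (auto simp: E_refl le_def)

lemma le_Plus: 
  assumes "le p p'" "le q q'"
  shows "le (p [+] q) (p' [+] q')"
proof -
  \<comment> \<open>One component is replaced at a time, since \<open>E_Un\<close> adds the same set
    on both sides.\<close>
  have "E (initials p' \<union> initials q') (initials p \<union> initials q')"
    using E_Un le_initials[OF assms(1)] .
  moreover have "E (initials p \<union> initials q') (initials p \<union> initials q)"
    using E_Un[OF le_initials[OF assms(2)]] by (simp add: Un_commute)
  ultimately have "E (initials p' \<union> initials q') (initials p \<union> initials q)"
    using E_trans by blast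
  moreover have "\<exists>u. transition (p' [+] q') a u \<and> obs M E u s Y"
    if "transition (p [+] q) a t" "ready t s Y" for a t s Y
    using that leD[OF assms(1), of a t s Y] leD[OF assms(2), of a t s Y] by auto
  ultimately show ?thesis
    by (intro leI) simp_all
qed

text \<open>
  A run of \<open>p [||] q\<close> uses \<open>p\<close> only through one of its ready traces, so \<open>p\<close> may be replaced by any
  process that matches this trace.
\<close>

lemma ready_Par_decompose:
  "ready (p [||] q) t Y \<Longrightarrow>
    \<exists>s Z. ready p s Z \<and> (\<forall>p'. obs M E p' s Z \<longrightarrow> obs M E (p' [||] q) t Y)"
proof (induction t arbitrary: p q)
  case Nil
  then have "ready p [] (initials p) \<and>
      (\<forall>p'. obs M E p' [] (initials p) \<longrightarrow> obs M E (p' [||] q) [] Y)"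
    using E_Un by auto
  then show ?case by blast
next
  case (Cons x t)
  obtain a X where x: "x = (a, X)" by fastforce
  have X: "X = initials p \<union> initials q" using Cons.prems x by auto
  from Cons.prems x consider
    (left) p1 where "transition p a p1" "ready (p1 [||] q) t Y" |
    (right) q1 where "transition q a q1" "ready (p [||] q1) t Y"
    by auto
  then show ?case
  proof cases
    case left
    obtain s Z where s: "ready p1 s Z" "\<And>p'. obs M E p' s Z \<Longrightarrow> obs M E (p' [||] q) t Y"
      using Cons.IH[OF left(2)] by blast
    have "ready p ((a, initials p) # s) Z"
      using left(1) s(1) by auto
    moreover have "obs M E (p' [||] q) (x # t) Y" if "obs M E p' ((a, initials p) # s) Z" for p'
    proof -
      from that obtain p1' where p1': "M (initials p') (initials p)" "transition p' a p1'" "obs M E p1' s Z"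
        by auto
      have "M (initials (p' [||] q)) X"
        unfolding X initials_simps by (rule M_Un, rule p1'(1))
      moreover have "transition (p' [||] q) a (p1' [||] q)" using p1'(2) by simp
      ultimately show ?thesis using s(2)[OF p1'(3)] unfolding x obs.simps by blast
    qed
    ultimately show ?thesis by blast
  next
    case right
    obtain s Z where s: "ready p s Z" "\<And>p'. obs M E p' s Z \<Longrightarrow> obs M E (p' [||] q1) t Y"
      using Cons.IH[OF right(2)] by blast
    have "obs M E (p' [||] q) (x # t) Y" if "obs M E p' s Z" for p'
    proof -
      have "M (initials (p' [||] q)) X"
        unfolding X initials_simps by (rule M_Un, rule obs_ready_initials[OF s(1) that])
      moreover have "transition (p' [||] q) a (p' [||] q1)" using right(1) by simp
      ultimately show ?thesis using s(2)[OF that] unfolding x obs.simps by blast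
    qed
    with s(1) show ?thesis by blast
  qed
qed

lemma le_Par_left:
  assumes "le p p'"
  shows "le (p [||] q) (p' [||] q)"
  unfolding le_def
proof (intro allI impI)
  fix t Y
  assume "ready (p [||] q) t Y"
  then obtain s Z where "ready p s Z" "obs M E p' s Z \<Longrightarrow> obs M E (p' [||] q) t Y"
    using ready_Par_decompose by blast
  with assms show "obs M E (p' [||] q) t Y"
    unfolding le_def by blast
qed

end


section \<open>Processes with equal ready traces\<close>

lemma ready_Par_commute: "ready (p [||] q) s Y \<Longrightarrow> ready (q [||] p) s Y"
proof (induction s arbitrary: p q)
  case (Cons x s)
  obtain a X where x: "x = (a, X)" by fastforce
  from Cons.prems x consider
    (left) p' where "transition p a p'" "ready (p' [||] q) s Y" |
    (right) q' where "transition q a q'" "ready (p [||] q') s Y"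
    by auto
  then show ?case
  proof cases
    case left
    then have "transition (q [||] p) a (q [||] p')" "ready (q [||] p') s Y"
      using Cons.IH by auto
    then show ?thesis using Cons.prems x by auto
  next
    case right
    then have "transition (q [||] p) a (q' [||] p)" "ready (q' [||] p) s Y"
      using Cons.IH by auto
    then show ?thesis using Cons.prems x by auto
  qed
qed auto

lemma ready_Par_Zero: "ready (p [||] Zero) s Y \<longleftrightarrow> ready p s Y"
proof (induction s arbitrary: p)
  case (Cons x s)
  show ?case by (cases x) (auto simp: Cons.IH intro: exI[of _ "_ [||] Zero"])
qed simp

text \<open>A state enters an observation only through its outgoing transitions. This settles the
  laws of \<open>[+]\<close> in E1 and also EL2.\<close>

lemma ready_cong_transition:
  assumes "\<And>a t. transition p a t \<longleftrightarrow> transition q a t"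
  shows "ready p = ready q"
proof -
  have "initials p = initials q" using assms by (simp add: initials_def)
  then show ?thesis
    by (intro ext, rename_tac s Y, case_tac s) (auto simp: assms)
qed

text \<open>The first transition of a nonempty trace belongs to one of the parts, and equal initials
  make the first set the same for both.\<close>

lemma ready_split:
  assumes "initials p1 = initials p" "initials p2 = initials p"
    and "\<And>a t. transition p a t \<longleftrightarrow> transition p1 a t \<or> transition p2 a t"
  shows "ready p s Y \<longleftrightarrow> ready p1 s Y \<or> ready p2 s Y"
  by (cases s) (use assms in auto)

text \<open>The semantic content of FP. While only \<open>q\<close> moves, no choice between the
  parts is made, so \<open>q\<close> varies in the induction; the first move of \<open>p\<close>
  selects a part.\<close>

lemma ready_Par_split:
  assumes "initials p1 = initials p" "initials p2 = initials p"
    and "\<And>a t. transition p a t \<longleftrightarrow> transition p1 a t \<or> transition p2 a t"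
  shows "ready (p [||] q) s Y \<longleftrightarrow> ready (p1 [||] q) s Y \<or> ready (p2 [||] q) s Y"
proof (induction s arbitrary: q)
  case (Cons x s)
  obtain a X where x: "x = (a, X)" by fastforce
  have "ready (p [||] q) (x # s) Y \<longleftrightarrow> initials p \<union> initials q = X \<and>
      ((\<exists>p'. transition p a p' \<and> ready (p' [||] q) s Y) \<or>
       (\<exists>q'. transition q a q' \<and> ready (p [||] q') s Y))" for p
    using x by auto
  then show ?case
    by (simp only: Cons.IH assms) blast
qed (simp add: assms)

context observation
begin

lemma le_Par: assumes "le p p'" "le q q'" shows "le (p [||] q) (p' [||] q')"
proof -
  have comm: "le (u [||] v) (v [||] u)" for u v
    using ready_subset_le ready_Par_commute by blast
  show ?thesis
    by (rule le_trans[OF le_Par_left[OF assms(1)]], rule le_trans[OF comm],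
        rule le_trans[OF le_Par_left[OF assms(2)]], rule comm)
qed

lemma soundness:
  assumes ax: "\<And>t u \<sigma>. (t, u) \<in> Ax \<Longrightarrow> le (psubst \<sigma> t) (psubst \<sigma> u) \<and> le (psubst \<sigma> u) (psubst \<sigma> t)"
    and "Ax \<turnstile> t \<approx> u"
  shows "le t u \<and> le u t"
  using assms(2)
proof induction
  case (drv_trans t u v)
  then show ?case using le_trans[of t u v] le_trans[of v u t] by blast
next
  case (drv_axiom t u \<sigma>)
  then show ?case by (rule ax)
qed (simp_all add: le_refl le_Act le_Plus le_Par)

end

section \<open>Soundness of the individual axioms\<close>

lemma psubst_psum: "psubst \<sigma> (psum ts) = psum (map (psubst \<sigma>) ts)"
  by (induction ts rule: psum.induct) auto


lemma ready_eq_E1: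
  assumes "(t, u) \<in> ax_E1"
  shows "ready (psubst \<sigma> t) = ready (psubst \<sigma> u)"
proof -
  have comm: "ready (p [||] q) = ready (q [||] p)" for p q :: "'a pterm"
    using ready_Par_commute by (intro ext) blast
  have zero: "ready (p [||] Zero) = ready p" for p :: "'a pterm"
    by (intro ext) (rule ready_Par_Zero)
  show ?thesis
    using assms unfolding ax_E1_def
    by (elim insertE emptyE; clarsimp) (rule comm | rule zero | rule ready_cong_transition, auto; fail)+
qed

lemma ready_eq_FP:
  assumes "(t, u) \<in> ax_FP"
  shows "ready (psubst \<sigma> t) = ready (psubst \<sigma> u)"
proof -
  have "ready ((Act a x [+] Act a y [+] w) [||] z) s Y \<longleftrightarrow>
      ready ((Act a x [+] w) [||] z [+] (Act a y [+] w) [||] z) s Y" for a :: 'a and x y z w s Y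
    by (subst ready_Par_split[of "Act a x [+] w" _ "Act a y [+] w"])
      (auto simp: ready_split[of "(Act a x [+] w) [||] z" _ "(Act a y [+] w) [||] z"])
  with assms show ?thesis
    by (auto simp: ax_FP_def fun_eq_iff)
qed

lemma ready_eq_EL2:
  assumes "(t, u) \<in> ax_EL2"
  shows "ready (psubst \<sigma> t) = ready (psubst \<sigma> u)"
proof -
  have "ready (psum (map (\<lambda>i. Act (as ! i) (x i)) ks) [||] psum (map (\<lambda>j. Act (bs ! j) (y j)) ls)) =
    ready (psum (map (\<lambda>i. Act (as ! i) (x i [||] psum (map (\<lambda>j. Act (bs ! j) (y j)) ls))) ks) [+]
           psum (map (\<lambda>j. Act (bs ! j) (psum (map (\<lambda>i. Act (as ! i) (x i)) ks) [||] y j)) ls))"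
    for as bs :: "'a list" and x y and ks ls :: "nat list"
    by (rule ready_cong_transition) (simp add: transition_psum, blast)
  with assms show ?thesis
    by (auto simp: ax_EL2_def Let_def psubst_psum comp_def)
qed

text \<open>Every \<open>b i\<close> stays initial in both halves, so \<open>ready_split\<close>
  divides the ready traces below the prefix.\<close>

lemma ready_eq_RT:
  assumes "(t, u) \<in> ax_RT"
  shows "ready (psubst \<sigma> t) = ready (psubst \<sigma> u)"
proof -
  have "ready (Act a (psum (map (\<lambda>i. Act (b i) (x i) [+] Act (b i) (y i)) ks) [+] z)) s Y \<longleftrightarrow>
    ready (Act a (psum (map (\<lambda>i. Act (b i) (x i)) ks) [+] z) [+]
           Act a (psum (map (\<lambda>i. Act (b i) (y i)) ks) [+] z)) s Y" (is "ready (Act a ?p) s Y \<longleftrightarrow> ready (Act a ?p1 [+] Act a ?p2) s Y")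
    for a :: 'a and b x y z s Y and ks :: "nat list"
  proof -
    have "ready ?p s Y \<longleftrightarrow> ready ?p1 s Y \<or> ready ?p2 s Y" for s Y
      by (rule ready_split) (auto simp: initials_psum transition_psum)
    then show ?thesis by (cases s) auto
  qed
  then have "ready (Act a (psum (map (\<lambda>i. Act (b i) (x i) [+] Act (b i) (y i)) ks) [+] z)) =
    ready (Act a (psum (map (\<lambda>i. Act (b i) (x i)) ks) [+] z) [+]
           Act a (psum (map (\<lambda>i. Act (b i) (y i)) ks) [+] z))"
    for a :: 'a and b x y z and ks :: "nat list"
    by (intro ext)
  with assms show ?thesis
    by (auto simp: ax_RT_def psubst_psum comp_def)
qed

text \<open>Dropping one of two \<open>b\<close>-summands keeps the initials, so the extra summand
  contributes only ready traces already present.\<close>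

lemma ready_eq_RS:
  assumes "(t, u) \<in> ax_RS"
  shows "ready (psubst \<sigma> t) = ready (psubst \<sigma> u)"
proof -
  have 1: "ready (Act b x [+] Act b y [+] z) s Y"
    if "ready (Act b x [+] z) s Y" for b :: 'a and x y z s Y
    using that by (cases s) (auto 0 2)
  have "ready (Act a p) s Y \<longleftrightarrow> ready (Act a p [+] Act a p') s Y"
    if "\<And>s Y. ready p' s Y \<Longrightarrow> ready p s Y" for a :: 'a and p p' s Y
    by (cases s) (auto dest: that)
  then have "ready (Act a (Act b x [+] Act b y [+] z)) s Y \<longleftrightarrow>
     ready (Act a (Act b x [+] Act b y [+] z) [+] Act a (Act b x [+] z)) s Y" for a b :: 'a and x y z s Y
    using 1 by blast
  with assms show ?thesis
    by (auto simp: ax_RS_def fun_eq_iff simp del: obs.simps)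
qed


lemma observation_rel: "observation (mid_rel X) (end_rel X)"
  by (cases X) (unfold_locales; auto)+

lemma ready_eq_imp_le:
  assumes "ready p = ready q"
  shows "observation.le (mid_rel X) (end_rel X) p q \<and> observation.le (mid_rel X) (end_rel X) q p"
proof -
  interpret observation "mid_rel X" "end_rel X" by (rule observation_rel)
  show ?thesis using assms by (auto intro: ready_subset_le)
qed

lemma sound_FT:
  assumes "(t, u) \<in> ax_FT"
  shows "observation.le (\<subseteq>) (\<subseteq>) (psubst \<sigma> t) (psubst \<sigma> u) \<and>
    observation.le (\<subseteq>) (\<subseteq>) (psubst \<sigma> u) (psubst \<sigma> t)"
proof -
  interpret observation "(\<subseteq>)" "(\<subseteq>)" by unfold_locales auto
  \<comment> \<open>A nonempty trace of a sum starts in one summand, and forgetting the other only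
    shrinks the initials, which inclusion tolerates.\<close>
  have sum: "obs (\<subseteq>) (\<subseteq>) x s Y \<or> obs (\<subseteq>) (\<subseteq>) y s Y" if "ready (x [+] y) s Y" for x y :: "'a pterm" and s Y
    using ready_imp_obs[OF that] by (cases s) auto
  have "le (Act a x [+] Act a y) (Act a x [+] Act a y [+] Act a (x [+] y))" for a :: 'a and x y
    by (rule leI) (auto intro: ready_imp_obs)
  moreover have "le (Act a x [+] Act a y [+] Act a (x [+] y)) (Act a x [+] Act a y)" for a :: 'a and x y
    by (rule leI) (auto intro: ready_imp_obs dest: sum)
  ultimately show ?thesis
    using assms by (auto simp: ax_FT_def)
qed

lemma sound_R:
  assumes "(t, u) \<in> ax_R" "observation (\<lambda>_ _. True) E"
  shows "observation.le (\<lambda>_ _. True) E (psubst \<sigma> t) (psubst \<sigma> u) \<and>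
    observation.le (\<lambda>_ _. True) E (psubst \<sigma> u) (psubst \<sigma> t)"
proof -
  interpret observation "\<lambda>_ _. True" E by fact
  let ?obs = "obs (\<lambda>_ _. True) E"
  have 1: "?obs (Act b x [+] Act b y [+] z) s Y" if "ready (Act b x [+] z) s Y"
    for b :: 'a and x y z s Y
    using ready_imp_obs[OF that] by (cases s) auto
  \<comment> \<open>Nothing is recorded on the way, so a trace entering \<open>y\<close> can be run
    in \<open>b.y + w\<close> whatever the initials of \<open>w\<close>. All others, including the
    empty one, can be run in \<open>b.x + z\<close>.\<close>
  have 2: "?obs (Act b x [+] z) s Y \<or> ?obs (Act b y [+] w) s Y"
    if "ready (Act b x [+] Act b y [+] z) s Y" for b :: 'a and x y z w s Y
    using ready_imp_obs[OF that] by (cases s) auto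
  have "le (Act a (Act b x [+] z) [+] Act a (Act b y [+] w))
           (Act a (Act b x [+] Act b y [+] z) [+] Act a (Act b y [+] w))" for a b :: 'a and x y z w
  proof (rule leI)
    fix c p' s Y
    assume "transition (Act a (Act b x [+] z) [+] Act a (Act b y [+] w)) c p'" "ready p' s Y"
    then show "\<exists>q'. transition (Act a (Act b x [+] Act b y [+] z) [+] Act a (Act b y [+] w)) c q' \<and> ?obs q' s Y"
      using 1[of b x z s Y y] ready_imp_obs[of p' s Y] by (auto simp del: obs.simps)
  qed (simp add: E_refl)
  moreover have "le (Act a (Act b x [+] Act b y [+] z) [+] Act a (Act b y [+] w))
           (Act a (Act b x [+] z) [+] Act a (Act b y [+] w))" for a b :: 'a and x y z w
  proof (rule leI)
    fix c p' s Y
    assume "transition (Act a (Act b x [+] Act b y [+] z) [+] Act a (Act b y [+] w)) c p'" "ready p' s Y"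
    then show "\<exists>q'. transition (Act a (Act b x [+] z) [+] Act a (Act b y [+] w)) c q' \<and> ?obs q' s Y"
      using 2[of b x y z s Y w] ready_imp_obs[of p' s Y] by (auto simp del: obs.simps)
  qed (simp add: E_refl)
  ultimately show ?thesis
    using assms(1) by (auto simp: ax_R_def)
qed

lemma sound_F:
  assumes "(t, u) \<in> ax_F"
  shows "observation.le (\<lambda>_ _. True) (\<subseteq>) (psubst \<sigma> t) (psubst \<sigma> u) \<and>
    observation.le (\<lambda>_ _. True) (\<subseteq>) (psubst \<sigma> u) (psubst \<sigma> t)"
proof -
  interpret observation "\<lambda>_ _. True" "(\<subseteq>)" by unfold_locales auto
  let ?obs = "obs (\<lambda>_ _. True) (\<subseteq>)"
  \<comment> \<open>The empty trace and those starting in \<open>x\<close> go to \<open>x\<close>,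
    which has no more initials than the sum. A trace starting in \<open>y\<close> goes to
    \<open>y + z\<close>, whose initials are not recorded.\<close>
  have sum: "?obs x s Y \<or> ?obs (y [+] z) s Y" if "ready (x [+] y) s Y" for x y z :: "'a pterm" and s Y
    using ready_imp_obs[OF that] by (cases s) auto
  have "le (Act a x [+] Act a (y [+] z)) (Act a x [+] Act a (x [+] y) [+] Act a (y [+] z))"
    for a :: 'a and x y z
    by (rule leI) (auto intro: ready_imp_obs)
  moreover have "le (Act a x [+] Act a (x [+] y) [+] Act a (y [+] z)) (Act a x [+] Act a (y [+] z))"
    for a :: 'a and x y z
  proof (rule leI)
    fix c p' s Y
    assume "transition (Act a x [+] Act a (x [+] y) [+] Act a (y [+] z)) c p'" "ready p' s Y"
    then show "\<exists>q'. transition (Act a x [+] Act a (y [+] z)) c q' \<and> ?obs q' s Y"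
      using sum[of x y s Y z] ready_imp_obs[of p' s Y] by (auto simp del: obs.simps)
  qed simp
  ultimately show ?thesis
    using assms by (auto simp: ax_F_def)
qed

text \<open>All axioms other than FT, R and F preserve ready traces and thus hold in every one of
  the semantics.\<close>

lemma axioms_sound:
  assumes "(t, u) \<in> axioms_of X"
  shows "observation.le (mid_rel X) (end_rel X) (psubst \<sigma> t) (psubst \<sigma> u) \<and>
    observation.le (mid_rel X) (end_rel X) (psubst \<sigma> u) (psubst \<sigma> t)"
proof -
  have ready: "(t, u) \<in> ax_E1 \<union> ax_FP \<union> ax_EL2 \<union> ax_RT \<union> ax_RS \<Longrightarrow> ?thesis"
    by (rule ready_eq_imp_le) (auto dest: ready_eq_E1 ready_eq_FP ready_eq_EL2 ready_eq_RT ready_eq_RS)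
  show ?thesis
  proof (cases X)
    case Ready_Trace
    with assms ready show ?thesis by auto
  next
    case Failure_Trace
    with assms ready sound_FT[of t u \<sigma>] show ?thesis by auto
  next
    case Readiness
    with assms ready sound_R[of t u _ \<sigma>] observation_rel[of X] show ?thesis by auto
  next
    case Failures
    with assms ready sound_R[of t u _ \<sigma>] sound_F[of t u \<sigma>] observation_rel[of X] show ?thesis by auto
  qed
qed

lemma derivable_imp_sem_equiv:
  assumes "axioms_of X \<turnstile> t \<approx> u"
  shows "sem_equiv X t u"
proof -
  interpret observation "mid_rel X" "end_rel X" by (rule observation_rel)
  show ?thesis
    using soundness[OF axioms_sound assms] by (simp add: sem_equiv_iff_obs obs_eq_iff_le)
qed


section \<open>Equational reasoning\<close>

locale equational =
  fixes Ax :: "('a pterm \<times> 'a pterm) set"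
  assumes E1: "ax_E1 \<subseteq> Ax" and FP: "ax_FP \<subseteq> Ax" and EL2: "ax_EL2 \<subseteq> Ax"
begin

abbreviation eqv :: "'a pterm \<Rightarrow> 'a pterm \<Rightarrow> bool" (infix "\<approx>" 50) where
  "t \<approx> u \<equiv> Ax \<turnstile> t \<approx> u"

definition subst4 :: "'a pterm \<Rightarrow> 'a pterm \<Rightarrow> 'a pterm \<Rightarrow> 'a pterm \<Rightarrow> nat \<Rightarrow> 'a pterm" where
  "subst4 x y z w n = (if n = 0 then x else if n = 1 then y else if n = 2 then z else w)"

lemma subst4_simps [simp]:
  "subst4 x y z w 0 = x" "subst4 x y z w (Suc 0) = y" "subst4 x y z w 2 = z" "subst4 x y z w 3 = w"
  by (simp_all add: subst4_def)

lemma A0: "x [+] Zero \<approx> x"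
  and A1: "x [+] y \<approx> y [+] x"
  and A2: "x [+] y [+] z \<approx> x [+] (y [+] z)"
  and A3: "x [+] x \<approx> x"
  and P0: "x [||] Zero \<approx> x"
  and P1: "x [||] y \<approx> y [||] x"
proof -
  have *: "psubst (subst4 x y z z) t \<approx> psubst (subst4 x y z z) u" if "(t, u) \<in> ax_E1" for t u
    using that E1 by (blast intro: drv_axiom)
  show "x [+] Zero \<approx> x" using *[of "Var 0 [+] Zero" "Var 0"] by (simp add: ax_E1_def)
  show "x [+] y \<approx> y [+] x" using *[of "Var 0 [+] Var 1" "Var 1 [+] Var 0"] by (simp add: ax_E1_def)
  show "x [+] y [+] z \<approx> x [+] (y [+] z)"
    using *[of "Var 0 [+] Var 1 [+] Var 2" "Var 0 [+] (Var 1 [+] Var 2)"] by (simp add: ax_E1_def)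
  show "x [+] x \<approx> x" using *[of "Var 0 [+] Var 0" "Var 0"] by (simp add: ax_E1_def)
  show "x [||] Zero \<approx> x" using *[of "Var 0 [||] Zero" "Var 0"] by (simp add: ax_E1_def)
  show "x [||] y \<approx> y [||] x" using *[of "Var 0 [||] Var 1" "Var 1 [||] Var 0"] by (simp add: ax_E1_def)
qed

lemma Par_split:
  "(Act a x [+] Act a y [+] w) [||] z \<approx> (Act a x [+] w) [||] z [+] (Act a y [+] w) [||] z"
proof -
  have "((Act a (Var 0) [+] Act a (Var 1) [+] Var 3) [||] Var 2,
      (Act a (Var 0) [+] Var 3) [||] Var 2 [+] (Act a (Var 1) [+] Var 3) [||] Var 2) \<in> Ax"
    using FP by (auto simp: ax_FP_def)
  from drv_axiom[OF this, of "subst4 x y z w"] show ?thesis by simp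
qed

text \<open>The join-semilattice order given by A1, A2 and A3, with \<open>Zero\<close> as least
  element by A0.\<close>

definition below :: "'a pterm \<Rightarrow> 'a pterm \<Rightarrow> bool" (infix "\<sqsubseteq>" 50) where
  "t \<sqsubseteq> u \<longleftrightarrow> u [+] t \<approx> u"

lemma eqv_trans [trans]: "t \<approx> u \<Longrightarrow> u \<approx> v \<Longrightarrow> t \<approx> v"
  by (rule drv_trans)

lemma below_refl [simp, intro]: "t \<sqsubseteq> t"
  unfolding below_def by (rule A3)

lemma eqv_imp_below: assumes "t \<approx> u" shows "t \<sqsubseteq> u"
  unfolding below_def
  using drv_plus[OF drv_refl assms] A3 by (rule drv_trans)

lemma below_trans [trans]:
  assumes "t \<sqsubseteq> u" "u \<sqsubseteq> v" shows "t \<sqsubseteq> v"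
proof -
  have uv: "v [+] u \<approx> v" and tu: "u [+] t \<approx> u" using assms by (simp_all add: below_def)
  have "v [+] t \<approx> v [+] u [+] t" using uv by (intro drv_plus drv_refl) (rule drv_sym)
  also have "v [+] u [+] t \<approx> v [+] (u [+] t)" by (rule A2)
  also have "v [+] (u [+] t) \<approx> v [+] u" using tu by (intro drv_plus drv_refl)
  also have "v [+] u \<approx> v" by fact
  finally show ?thesis unfolding below_def .
qed

lemma below_antisym: assumes "t \<sqsubseteq> u" "u \<sqsubseteq> t" shows "t \<approx> u"
proof -
  have "t \<approx> t [+] u" using assms(2) unfolding below_def by (rule drv_sym)
  also have "t [+] u \<approx> u [+] t" by (rule A1)
  also have "u [+] t \<approx> u" using assms(1) unfolding below_def .
  finally show ?thesis .
qed

lemma Zero_below [simp, intro]: "Zero \<sqsubseteq> t"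
  unfolding below_def by (rule A0)

lemma below_Plus_right: "t \<sqsubseteq> u [+] t"
proof -
  have "u [+] t [+] t \<approx> u [+] (t [+] t)" by (rule A2)
  also have "u [+] (t [+] t) \<approx> u [+] t" by (intro drv_plus drv_refl A3)
  finally show ?thesis unfolding below_def .
qed

lemma below_Plus_left: "t \<sqsubseteq> t [+] u"
  using below_Plus_right eqv_imp_below[OF A1] by (rule below_trans)

lemma below_PlusI1: "t \<sqsubseteq> u \<Longrightarrow> t \<sqsubseteq> u [+] v"
  by (rule below_trans[OF _ below_Plus_left])

lemma below_PlusI2: "t \<sqsubseteq> v \<Longrightarrow> t \<sqsubseteq> u [+] v"
  by (rule below_trans[OF _ below_Plus_right])

lemma Plus_belowI:
  assumes "t \<sqsubseteq> v" "u \<sqsubseteq> v" shows "t [+] u \<sqsubseteq> v"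
proof -
  have "v [+] (t [+] u) \<approx> v [+] t [+] u" by (rule drv_sym[OF A2])
  also have "v [+] t [+] u \<approx> v [+] u" using assms(1) unfolding below_def by (intro drv_plus drv_refl)
  also have "v [+] u \<approx> v" using assms(2) unfolding below_def .
  finally show ?thesis unfolding below_def .
qed

lemma Plus_absorb: "t \<sqsubseteq> u \<Longrightarrow> t [+] u \<approx> u"
  unfolding below_def by (rule drv_trans[OF A1])

lemmas belowI = below_PlusI1 below_PlusI2 Plus_belowI

text \<open>Only equations pass freely under a prefix: in all four theories \<open>0\<close> is
  absorbed by \<open>b.0\<close>, but \<open>a.0\<close> is not absorbed by
  \<open>a.(b.0)\<close>.\<close>

lemma Act_mono_eqv: "t \<approx> u \<Longrightarrow> Act a t \<sqsubseteq> Act a u"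
  by (intro eqv_imp_below drv_act)

lemma below_psum: "t \<in> set ts \<Longrightarrow> t \<sqsubseteq> psum ts"
  by (induction ts rule: psum.induct) (auto intro: belowI)

lemma psum_below: "(\<And>t. t \<in> set ts \<Longrightarrow> t \<sqsubseteq> u) \<Longrightarrow> psum ts \<sqsubseteq> u"
  by (induction ts rule: psum.induct) (auto intro: belowI)

lemma psum_eqvI:
  assumes "\<And>t. t \<in> set ts \<Longrightarrow> t \<sqsubseteq> psum us" "\<And>u. u \<in> set us \<Longrightarrow> u \<sqsubseteq> psum ts"
  shows "psum ts \<approx> psum us"
  using assms by (intro below_antisym psum_below)

lemma psum_cong:
  assumes "\<And>x. x \<in> set xs \<Longrightarrow> f x \<approx> g x"
  shows "psum (map f xs) \<approx> psum (map g xs)"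
proof (rule psum_eqvI)
  fix t
  assume "t \<in> set (map f xs)"
  then obtain x where "x \<in> set xs" "t = f x" by auto
  then show "t \<sqsubseteq> psum (map g xs)"
    using below_trans[OF eqv_imp_below[OF assms] below_psum] by simp
next
  fix t
  assume "t \<in> set (map g xs)"
  then obtain x where "x \<in> set xs" "t = g x" by auto
  then show "t \<sqsubseteq> psum (map f xs)"
    using below_trans[OF eqv_imp_below[OF drv_sym[OF assms]] below_psum] by simp
qed

end


section \<open>Elimination of parallel composition\<close>

primrec basic :: "'a pterm \<Rightarrow> bool" where
  "basic Zero = True"
| "basic (Var v) = False"
| "basic (Act a t) = basic t"
| "basic (t [+] u) = (basic t \<and> basic u)"
| "basic (t [||] u) = False"

text \<open>Unlike \<open>size\<close>, this ignores \<open>[+]\<close> and \<open>Zero\<close>, so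
  bringing a basic term into head normal form leaves it unchanged.\<close>

primrec count_Act :: "'a pterm \<Rightarrow> nat" where
  "count_Act Zero = 0"
| "count_Act (Var v) = 0"
| "count_Act (Act a t) = Suc (count_Act t)"
| "count_Act (t [+] u) = count_Act t + count_Act u"
| "count_Act (t [||] u) = count_Act t + count_Act u"

text \<open>Keeping actions and derivatives as pairs lets repeated initial actions be detected, as
  FP and EL2 require.\<close>

definition summands :: "('a \<times> 'a pterm) list \<Rightarrow> 'a pterm list" where
  "summands l = map (\<lambda>(a, t). Act a t) l"

lemma basic_psum: "basic (psum ts) \<longleftrightarrow> (\<forall>t\<in>set ts. basic t)"
  by (induction ts rule: psum.induct) auto

lemma set_summands: "set (summands l) = {Act a t | a t. (a, t) \<in> set l}"
  by (auto simp: summands_def image_iff)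

lemma initials_summands: "initials (psum (summands l)) = fst ` set l"
  by (induction l) (auto simp: initials_psum summands_def)

lemma not_distinct_fst_decomp:
  assumes "\<not> distinct (map fst l)"
  obtains a x y l1 l2 l3 where "l = l1 @ (a, x) # l2 @ (a, y) # l3"
proof -
  obtain u v w a where *: "map fst l = u @ [a] @ v @ [a] @ w"
    using not_distinct_decomp[OF assms] by blast
  then obtain l1 m1 where 1: "l = l1 @ m1" "map fst m1 = a # v @ a # w"
    by (auto simp: map_eq_append_conv)
  then obtain p m2 where 2: "m1 = p # m2" "fst p = a" "map fst m2 = v @ a # w"
    by (auto simp: map_eq_Cons_conv)
  then obtain l2 m3 where 3: "m2 = l2 @ m3" "map fst m3 = a # w"
    by (auto simp: map_eq_append_conv)
  then obtain q l3 where 4: "m3 = q # l3" "fst q = a"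
    by (auto simp: map_eq_Cons_conv)
  have "l = l1 @ p # l2 @ q # l3" "fst p = a" "fst q = a"
    using 1 2 3 4 by simp_all
  then show thesis using that[of l1 a "snd p" l2 "snd q" l3] by (metis prod.collapse)
qed

context equational
begin

lemma Act_below_summands: "(a, t) \<in> set l \<Longrightarrow> Act a t \<sqsubseteq> psum (summands l)"
  by (rule below_psum) (auto simp: set_summands)

lemma summands_below: "(\<And>a t. (a, t) \<in> set l \<Longrightarrow> Act a t \<sqsubseteq> u) \<Longrightarrow> psum (summands l) \<sqsubseteq> u"
  by (rule psum_below) (auto simp: set_summands)

lemma Par_expand:
  assumes "distinct (map fst k)" "distinct (map fst l)"
  shows "psum (summands k) [||] psum (summands l) \<approx>
    psum (map (\<lambda>(a, t). Act a (t [||] psum (summands l))) k) [+]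
    psum (map (\<lambda>(b, u). Act b (psum (summands k) [||] u)) l)"
proof -
  \<comment> \<open>In EL2 the variables \<open>2 * i + 1\<close> and \<open>2 * j + 2\<close> stand
    for the derivatives on the left and on the right. Halving recovers the index, with one to
    subtract in the even case.\<close>
  define \<sigma> where "\<sigma> n = (if odd n then snd (k ! (n div 2)) else snd (l ! (n div 2 - 1)))" for n :: nat
  have \<sigma>: "\<sigma> (Suc (2 * i)) = snd (k ! i)" "\<sigma> (Suc (Suc (2 * i))) = snd (l ! i)" for i
    by (simp_all add: \<sigma>_def)
  let ?P = "psum (map (\<lambda>i. Act (map fst k ! i) (Var (2 * i + 1))) [0..<length (map fst k)])"
  let ?Q = "psum (map (\<lambda>j. Act (map fst l ! j) (Var (2 * j + 2))) [0..<length (map fst l)])"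
  have list: "map (\<lambda>i. f (map fst m ! i) (snd (m ! i))) [0..<length (map fst m)] = map (\<lambda>(a, t). f a t) m"
    for f :: "'a \<Rightarrow> 'a pterm \<Rightarrow> 'a pterm" and m
    by (rule nth_equalityI) (auto simp: case_prod_beta)
  have P: "psubst \<sigma> ?P = psum (summands k)" and Q: "psubst \<sigma> ?Q = psum (summands l)"
    unfolding psubst_psum summands_def list[symmetric] by (simp_all add: comp_def \<sigma>)
  have k: "psubst \<sigma> (psum (map (\<lambda>i. Act (map fst k ! i) (Var (2 * i + 1) [||] t)) [0..<length (map fst k)])) =
      psum (map (\<lambda>(a, u). Act a (u [||] psubst \<sigma> t)) k)" for t
    unfolding psubst_psum list[symmetric] by (simp add: comp_def \<sigma>)
  have l: "psubst \<sigma> (psum (map (\<lambda>j. Act (map fst l ! j) (t [||] Var (2 * j + 2))) [0..<length (map fst l)])) =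
      psum (map (\<lambda>(a, u). Act a (psubst \<sigma> t [||] u)) l)" for t
    unfolding psubst_psum list[symmetric] by (simp add: comp_def \<sigma>)
  have "(?P [||] ?Q,
      psum (map (\<lambda>i. Act (map fst k ! i) (Var (2 * i + 1) [||] ?Q)) [0..<length (map fst k)]) [+]
      psum (map (\<lambda>j. Act (map fst l ! j) (?P [||] Var (2 * j + 2))) [0..<length (map fst l)])) \<in> Ax"
    using EL2 assms unfolding ax_EL2_def Let_def by blast
  from drv_axiom[OF this, of \<sigma>]
  show ?thesis
    unfolding psubst.simps(4,5) k l P Q .
qed

text \<open>The exact count of prefixes is the measure for eliminating \<open>[||]\<close>; the
  description of \<open>set l\<close> by transitions serves the merging under RT.\<close>

lemma head_normal_form:
  "basic t \<Longrightarrow> \<exists>l. t \<approx> psum (summands l) \<and>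
    sum_list (map (\<lambda>(a, u). Suc (count_Act u)) l) = count_Act t \<and> (\<forall>(a, u)\<in>set l. basic u) \<and>
    set l = {(a, u). transition t a u}"
proof (induction t)
  case Zero
  then show ?case by (intro exI[of _ "[]"]) (simp add: summands_def drv_refl)
next
  case (Act a t)
  then show ?case by (intro exI[of _ "[(a, t)]"]) (simp add: summands_def drv_refl)
next
  case (Plus t1 t2)
  then obtain l1 l2 where
    l: "t1 \<approx> psum (summands l1)" "sum_list (map (\<lambda>(a, u). Suc (count_Act u)) l1) = count_Act t1"
       "\<forall>(a, u)\<in>set l1. basic u" "set l1 = {(a, u). transition t1 a u}"
       "t2 \<approx> psum (summands l2)" "sum_list (map (\<lambda>(a, u). Suc (count_Act u)) l2) = count_Act t2"
       "\<forall>(a, u)\<in>set l2. basic u" "set l2 = {(a, u). transition t2 a u}"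
    by auto
  have "t1 [+] t2 \<approx> psum (summands l1) [+] psum (summands l2)"
    using l by (intro drv_plus)
  also have "psum (summands l1) [+] psum (summands l2) \<approx> psum (summands (l1 @ l2))"
    by (intro below_antisym Plus_belowI summands_below)
      (auto intro: Act_below_summands below_PlusI1 below_PlusI2)
  finally show ?case using l by (intro exI[of _ "l1 @ l2"]) auto
qed auto

text \<open>Induction on the total number of prefixes: FP yields two compositions that each lack a
  summand, and EL2 leaves only compositions in which one component has lost a prefix.\<close>

lemma basic_Par_summands:
  assumes "\<forall>(a, t)\<in>set k. basic t" "\<forall>(a, t)\<in>set l. basic t"
  shows "\<exists>r. basic r \<and> psum (summands k) [||] psum (summands l) \<approx> r"
  using assms
proof (induction "sum_list (map (\<lambda>(a, u). Suc (count_Act u)) k) +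
    sum_list (map (\<lambda>(a, u). Suc (count_Act u)) l)" arbitrary: k l rule: less_induct)
  case less
  let ?S = "\<lambda>l. psum (summands l)"
  let ?n = "\<lambda>l :: ('a \<times> 'a pterm) list. sum_list (map (\<lambda>(a, u). Suc (count_Act u)) l)"
  \<comment> \<open>Kept general, with the induction hypothesis as a premise, so that P1 carries it
    over to repetitions in the right component.\<close>
  have split: "\<exists>r. basic r \<and> ?S k [||] ?S l \<approx> r"
    if "\<not> distinct (map fst k)" and bk: "\<forall>(a, t)\<in>set k. basic t"
      and IH: "\<And>k'. ?n k' < ?n k \<Longrightarrow> \<forall>(a, t)\<in>set k'. basic t \<Longrightarrow> \<exists>r. basic r \<and> ?S k' [||] ?S l \<approx> r"
    for k l
  proof -
    obtain a x y l1 l2 l3 where k: "k = l1 @ (a, x) # l2 @ (a, y) # l3"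
      using \<open>\<not> distinct (map fst k)\<close> by (rule not_distinct_fst_decomp)
    define w where "w = l1 @ l2 @ l3"
    have S: "?S k \<approx> Act a x [+] Act a y [+] ?S w"
      by (intro below_antisym Plus_belowI summands_below)
        (auto simp: k w_def intro: Act_below_summands below_PlusI1 below_PlusI2
          below_PlusI2[OF Act_below_summands])
    have S': "Act a z [+] ?S w \<approx> ?S ((a, z) # w)" for z
      by (intro below_antisym Plus_belowI summands_below)
        (auto intro: Act_below_summands below_PlusI1 below_PlusI2)
    obtain r1 where r1: "basic r1" "?S ((a, x) # w) [||] ?S l \<approx> r1"
      using IH[of "(a, x) # w"] bk by (auto simp: k w_def)
    obtain r2 where r2: "basic r2" "?S ((a, y) # w) [||] ?S l \<approx> r2"
      using IH[of "(a, y) # w"] bk by (auto simp: k w_def)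
    have "?S k [||] ?S l \<approx> (Act a x [+] Act a y [+] ?S w) [||] ?S l"
      by (intro drv_par S drv_refl)
    also have "\<dots> \<approx> (Act a x [+] ?S w) [||] ?S l [+] (Act a y [+] ?S w) [||] ?S l"
      by (rule Par_split)
    also have "\<dots> \<approx> ?S ((a, x) # w) [||] ?S l [+] ?S ((a, y) # w) [||] ?S l"
      by (intro drv_plus drv_par S' drv_refl)
    also have "\<dots> \<approx> r1 [+] r2"
      by (intro drv_plus r1 r2)
    finally show ?thesis using r1 r2 by (intro exI[of _ "r1 [+] r2"]) auto
  qed
  consider "\<not> distinct (map fst k)" | "\<not> distinct (map fst l)"
    | "distinct (map fst k)" "distinct (map fst l)"
    by blast
  then show ?case
  proof cases
    case 1
    show ?thesis
      by (rule split[OF 1 less.prems(1)]) (rule less.hyps, use less.prems(2) in auto)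
  next
    case 2
    have "\<exists>r. basic r \<and> ?S l [||] ?S k \<approx> r"
    proof (rule split[OF 2 less.prems(2)])
      fix l'
      assume "?n l' < ?n l" "\<forall>(a, t)\<in>set l'. basic t"
      then obtain r where "basic r" "?S k [||] ?S l' \<approx> r"
        using less.hyps[of k l'] less.prems(1) by auto
      then show "\<exists>r. basic r \<and> ?S l' [||] ?S k \<approx> r"
        using drv_trans[OF P1] by blast
    qed
    then show ?thesis using drv_trans[OF P1] by blast
  next
    case 3
    have left: "\<exists>r. basic r \<and> t [||] ?S l \<approx> r" if in_k: "(a, t) \<in> set k" for a t
    proof -
      \<comment> \<open>\<open>m\<close> weighs one less than the summand \<open>a.t\<close> of
        \<open>k\<close>, so the induction hypothesis will apply.\<close>
      obtain m where m: "t \<approx> ?S m" "?n m = count_Act t" "\<forall>(a, u)\<in>set m. basic u"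
        using head_normal_form[of t] in_k less.prems(1) by auto
      have "?n m < ?n k"
        using member_le_sum_list[of "Suc (count_Act t)" "map (\<lambda>(a, u). Suc (count_Act u)) k"] in_k m(2)
        by force
      then obtain r where "basic r" "?S m [||] ?S l \<approx> r"
        using less.hyps[of m l] m(3) less.prems(2) by auto
      moreover have "t [||] ?S l \<approx> ?S m [||] ?S l" by (intro drv_par m drv_refl)
      ultimately show ?thesis using drv_trans by blast
    qed
    have right: "\<exists>r. basic r \<and> ?S k [||] t \<approx> r" if in_l: "(a, t) \<in> set l" for a t
    proof -
      obtain m where m: "t \<approx> ?S m" "?n m = count_Act t" "\<forall>(a, u)\<in>set m. basic u"
        using head_normal_form[of t] in_l less.prems(2) by auto
      have "?n m < ?n l"
        using member_le_sum_list[of "Suc (count_Act t)" "map (\<lambda>(a, u). Suc (count_Act u)) l"] in_l m(2)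
        by force
      then obtain r where "basic r" "?S k [||] ?S m \<approx> r"
        using less.hyps[of k m] m(3) less.prems(1) by auto
      moreover have "?S k [||] t \<approx> ?S k [||] ?S m" by (intro drv_par m drv_refl)
      ultimately show ?thesis using drv_trans by blast
    qed
    have "\<forall>t\<in>snd ` set k. \<exists>r. basic r \<and> t [||] ?S l \<approx> r"
      using left by auto
    then obtain f where "\<forall>t\<in>snd ` set k. basic (f t) \<and> t [||] ?S l \<approx> f t"
      using bchoice by meson
    then have f: "\<And>a t. (a, t) \<in> set k \<Longrightarrow> basic (f t) \<and> t [||] ?S l \<approx> f t"
      by force
    have "\<forall>t\<in>snd ` set l. \<exists>r. basic r \<and> ?S k [||] t \<approx> r"
      using right by auto
    then obtain g where "\<forall>t\<in>snd ` set l. basic (g t) \<and> ?S k [||] t \<approx> g t"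
      using bchoice by meson
    then have g: "\<And>a t. (a, t) \<in> set l \<Longrightarrow> basic (g t) \<and> ?S k [||] t \<approx> g t"
      by force
    have "?S k [||] ?S l \<approx> psum (map (\<lambda>(a, t). Act a (t [||] ?S l)) k) [+]
        psum (map (\<lambda>(b, u). Act b (?S k [||] u)) l)"
      using 3 by (rule Par_expand)
    also have "\<dots> \<approx> psum (map (\<lambda>(a, t). Act a (f t)) k) [+] psum (map (\<lambda>(a, t). Act a (g t)) l)"
      by (intro drv_plus psum_cong) (auto intro!: drv_act dest: f g)
    finally show ?thesis
      by (intro exI[of _ "psum (map (\<lambda>(a, t). Act a (f t)) k) [+] psum (map (\<lambda>(a, t). Act a (g t)) l)"])
        (auto simp: basic_psum dest: f g)
  qed
qed

lemma basic_representative: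
  "closed_term t \<Longrightarrow> \<exists>r. basic r \<and> t \<approx> r"
proof (induction t)
  case Zero
  show ?case by (intro exI[of _ Zero]) (simp add: drv_refl)
next
  case (Act a t)
  then show ?case by (metis basic.simps(3) drv_act closed_term_def vars.simps(3))
next
  case (Plus t u)
  then obtain r s where "basic r" "t \<approx> r" "basic s" "u \<approx> s"
    by (auto simp: closed_term_def)
  then show ?case by (intro exI[of _ "r [+] s"]) (auto intro: drv_plus)
next
  case (Par t u)
  then obtain r s where rs: "basic r" "t \<approx> r" "basic s" "u \<approx> s"
    by (auto simp: closed_term_def)
  obtain k l where kl: "r \<approx> psum (summands k)" "s \<approx> psum (summands l)"
    "\<forall>(a, u)\<in>set k. basic u" "\<forall>(a, u)\<in>set l. basic u"
    using head_normal_form rs by metis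
  then obtain v where "basic v" "psum (summands k) [||] psum (summands l) \<approx> v"
    using basic_Par_summands by blast
  moreover have "t [||] u \<approx> psum (summands k) [||] psum (summands l)"
    by (intro drv_par drv_trans[OF rs(2) kl(1)] drv_trans[OF rs(4) kl(2)])
  ultimately show ?case using drv_trans by blast
qed (simp add: closed_term_def)

end


section \<open>Completeness\<close>

lemma basic_transition:
  assumes "basic t" "transition t a t'"
  shows "basic t' \<and> size t' < size t"
  using assms by (induction t) auto

text \<open>When \<open>M\<close> is trivial, a derivative to be merged may have initials outside
  \<open>B\<close>, which must not enter the result. For the trace semantics
  \<open>M (initials q) B\<close> implies inclusion in \<open>B\<close>, and nothing is cut.\<close>

primrec restrict_initials :: "'a set \<Rightarrow> 'a pterm \<Rightarrow> 'a pterm" where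
  "restrict_initials B Zero = Zero"
| "restrict_initials B (Var v) = Var v"
| "restrict_initials B (Act a t) = (if a \<in> B then Act a t else Zero)"
| "restrict_initials B (t [+] u) = restrict_initials B t [+] restrict_initials B u"
| "restrict_initials B (t [||] u) = t [||] u"

lemma basic_restrict_initials: "basic t \<Longrightarrow> basic (restrict_initials B t)"
  by (induction t) auto

lemma transition_restrict_initials:
  "basic t \<Longrightarrow> transition (restrict_initials B t) a t' \<longleftrightarrow> a \<in> B \<and> transition t a t'"
  by (induction t) auto

lemma restrict_initials_id: "basic t \<Longrightarrow> initials t \<subseteq> B \<Longrightarrow> restrict_initials B t = t"
  by (induction t) auto

context equational
begin

lemma Act_below_basic: "basic t \<Longrightarrow> transition t a t' \<Longrightarrow> Act a t' \<sqsubseteq> t"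
  by (induction t) (auto intro: below_PlusI1 below_PlusI2)

text \<open>Together with \<open>Act_below_basic\<close>: a basic term is the least upper bound of
  the prefixes given by its transitions, so absorption can be checked one transition at a
  time.\<close>

lemma basic_below: "basic t \<Longrightarrow> (\<And>a t'. transition t a t' \<Longrightarrow> Act a t' \<sqsubseteq> u) \<Longrightarrow> t \<sqsubseteq> u"
  by (induction t) (auto intro: Plus_belowI)

end

text \<open>The common part of all four systems: RS is an axiom for failure traces, follows from RT
  for ready traces, and from R for readiness and failures.\<close>

locale equational_RS = equational +
  assumes RS: "Act a (Act b x [+] z) \<sqsubseteq> Act a (Act b x [+] Act b y [+] z)"
begin

text \<open>The prefixes of \<open>q\<close> are added one by one. For each \<open>b.y\<close> the
  term \<open>p\<close> already absorbs some \<open>b.x\<close>, and this is the partner that RS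
  asks for.\<close>

lemma Act_below_Act_Plus:
  assumes "basic p" "basic q" "initials q \<subseteq> initials p"
  shows "Act a p \<sqsubseteq> Act a (p [+] q)"
  using assms
proof (induction q arbitrary: p)
  case Zero
  show ?case by (rule Act_mono_eqv[OF drv_sym[OF A0]])
next
  case (Act b y)
  then obtain x where x: "Act b x \<sqsubseteq> p"
    by (auto simp: initials_def intro: Act_below_basic)
  have "Act a p \<sqsubseteq> Act a (Act b x [+] p)"
    by (intro Act_mono_eqv below_antisym belowI below_refl x)
  also have "\<dots> \<sqsubseteq> Act a (Act b x [+] Act b y [+] p)" by (rule RS)
  also have "\<dots> \<sqsubseteq> Act a (p [+] Act b y)"
    by (intro Act_mono_eqv below_antisym Plus_belowI) (auto intro: below_PlusI1 below_PlusI2 x)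
  finally show ?case .
next
  case (Plus q1 q2)
  have "Act a p \<sqsubseteq> Act a (p [+] q1)" using Plus.IH(1)[of p] Plus.prems by simp
  also have "\<dots> \<sqsubseteq> Act a (p [+] q1 [+] q2)" using Plus.IH(2)[of "p [+] q1"] Plus.prems by auto
  also have "\<dots> \<sqsubseteq> Act a (p [+] (q1 [+] q2))" by (rule Act_mono_eqv[OF A2])
  finally show ?case .
qed auto

text \<open>Since \<open>p [+] q\<close> equals \<open>q\<close> here, adding summands by RS becomes
  conditional monotonicity of prefixing.\<close>

lemma Act_mono_below:
  assumes "basic p" "basic q" "p \<sqsubseteq> q" "initials q \<subseteq> initials p"
  shows "Act a p \<sqsubseteq> Act a q"
proof -
  have "Act a p \<sqsubseteq> Act a (p [+] q)" using assms by (intro Act_below_Act_Plus)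
  also have "\<dots> \<sqsubseteq> Act a q"
    by (intro Act_mono_eqv below_antisym Plus_belowI assms below_refl below_Plus_right)
  finally show ?thesis .
qed

end

locale complete_axioms = equational_RS Ax + observation M E
  for Ax :: "('a pterm \<times> 'a pterm) set" and M E :: "'a set \<Rightarrow> 'a set \<Rightarrow> bool" +
  assumes merge: "basic p \<Longrightarrow> basic q \<Longrightarrow> E (initials p) B \<Longrightarrow> M (initials q) B \<Longrightarrow>
    Act a (p [+] restrict_initials B q) \<sqsubseteq> Act a p [+] Act a q"
begin

text \<open>The merge starts from \<open>q0\<close>, the one derivative known to satisfy
  \<open>E\<close>, and takes in the others one at a time. Cutting them down to \<open>B\<close>
  keeps \<open>E\<close> intact.\<close>

lemma merge_derivatives:
  assumes "finite S" "basic q" "\<And>q'. q' \<in> S \<Longrightarrow> transition q a q' \<and> M (initials q') B"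
    and q0: "transition q a q0" "E (initials q0) B"
  shows "\<exists>r. basic r \<and> Act a r \<sqsubseteq> q \<and> E (initials r) B \<and>
    (\<forall>q'\<in>S. \<forall>b\<in>B. \<forall>q''. transition q' b q'' \<longrightarrow> transition r b q'')"
  using assms(1,3)
proof (induction S)
  case empty
  then show ?case
    using q0 Act_below_basic[OF assms(2) q0(1)] basic_transition[OF assms(2) q0(1)] by blast
next
  case (insert q1 S)
  then obtain r where r: "basic r" "Act a r \<sqsubseteq> q" "E (initials r) B"
    "\<forall>q'\<in>S. \<forall>b\<in>B. \<forall>q''. transition q' b q'' \<longrightarrow> transition r b q''"
    by blast
  have q1: "transition q a q1" "M (initials q1) B" using insert.prems by auto
  have b1: "basic q1" using basic_transition[OF assms(2) q1(1)] by simp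
  let ?r = "r [+] restrict_initials B q1"
  have "Act a ?r \<sqsubseteq> Act a r [+] Act a q1"
    using merge[OF r(1) b1 r(3) q1(2)] .
  also have "\<dots> \<sqsubseteq> q"
    using r(2) Act_below_basic[OF assms(2) q1(1)] by (rule Plus_belowI)
  finally have "Act a ?r \<sqsubseteq> q" .
  moreover have "E (initials ?r) B"
  proof -
    have sub: "initials (restrict_initials B q1) \<subseteq> B"
      using transition_restrict_initials[OF b1] by (auto simp: initials_def)
    then have "B \<union> initials (restrict_initials B q1) = B" by blast
    then show ?thesis using E_Un[OF r(3), of "initials (restrict_initials B q1)"] by simp
  qed
  ultimately show ?case
    using r(1,4) b1 transition_restrict_initials[OF b1]
    by (intro exI[of _ ?r]) (auto simp: basic_restrict_initials)
qed

lemma finite_derivatives: "finite {q'. transition q a q'}"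
proof (induction q)
  case (Plus q1 q2)
  then show ?case by (simp add: Collect_disj_eq)
next
  case (Par q1 q2)
  have "{q'. transition (q1 [||] q2) a q'} =
      (\<lambda>q'. q' [||] q2) ` {q'. transition q1 a q'} \<union> (\<lambda>q'. q1 [||] q') ` {q'. transition q2 a q'}"
    by auto
  with Par show ?case by simp
qed auto

text \<open>
  All matching \<open>a\<close>-derivatives of \<open>q\<close> are merged into one \<open>r\<close> with \<open>a.r \<sqsubseteq> q\<close>; by induction \<open>r\<close> absorbs
  every summand of \<open>p\<close>, and then the summands of \<open>r\<close> that are not in \<open>p\<close> can be dropped below \<open>a\<close>.
\<close>

lemma Act_absorbed:
  assumes "basic p" "basic q"
    and "\<And>s Y. ready p s Y \<Longrightarrow> \<exists>q'. transition q a q' \<and> obs M E q' s Y"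
  shows "Act a p \<sqsubseteq> q"
  using assms
proof (induction "size p" arbitrary: a p q rule: less_induct)
  case less
  let ?B = "initials p"
  \<comment> \<open>The empty trace supplies the starting point of the merge.\<close>
  obtain q0 where q0: "transition q a q0" "E (initials q0) ?B"
    using less.prems(3)[of "[]" ?B] by auto
  let ?S = "{q'. transition q a q' \<and> M (initials q') ?B}"
  have "finite ?S" using finite_derivatives[of q a] by simp
  then obtain r where r: "basic r" "Act a r \<sqsubseteq> q" "E (initials r) ?B"
    "\<And>q' b q''. q' \<in> ?S \<Longrightarrow> b \<in> ?B \<Longrightarrow> transition q' b q'' \<Longrightarrow> transition r b q''"
    using merge_derivatives[of ?S q a ?B q0] less.prems(2) q0 by blast
  have "p \<sqsubseteq> r"
  proof (rule basic_below[OF less.prems(1)])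
    fix b p'
    assume p': "transition p b p'"
    show "Act b p' \<sqsubseteq> r"
    proof (rule less.hyps)
      fix s Y
      assume "ready p' s Y"
      \<comment> \<open>Prefixing the trace with \<open>?B\<close> forces the matching derivative of
        \<open>q\<close> into \<open>?S\<close>, so its \<open>b\<close>-derivatives are also
        derivatives of \<open>r\<close>.\<close>
      then have "ready p ((b, ?B) # s) Y" using p' by auto
      from less.prems(3)[OF this] obtain q' q'' where
        "transition q a q'" "M (initials q') ?B" "transition q' b q''" "obs M E q'' s Y"
        by auto
      moreover have "b \<in> ?B" using p' by (auto simp: initials_def)
      ultimately show "\<exists>q''. transition r b q'' \<and> obs M E q'' s Y"
        using r(4) by blast
    qed (use basic_transition[OF less.prems(1) p'] r(1) in auto)
  qed
  then have "Act a p \<sqsubseteq> Act a r"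
    using less.prems(1) r(1) E_subset[OF r(3)] by (intro Act_mono_below)
  also have "\<dots> \<sqsubseteq> q" by (rule r(2))
  finally show ?case .
qed

lemma le_imp_below:
  assumes "basic p" "basic q" "le p q"
  shows "p \<sqsubseteq> q"
  using assms(1)
proof (rule basic_below)
  fix a p'
  assume p': "transition p a p'"
  show "Act a p' \<sqsubseteq> q"
    using basic_transition[OF assms(1) p'] assms(2) leD[OF assms(3) p'] by (intro Act_absorbed) auto
qed

lemma completeness_basic:
  assumes "basic p" "basic q" "obs M E p = obs M E q"
  shows "p \<approx> q"
  using assms le_imp_below by (intro below_antisym) (auto simp: obs_eq_iff_le)

end

section \<open>Readiness and failures: consequences of R\<close>

locale equational_R = equational +
  assumes R: "ax_R \<subseteq> Ax"
begin

lemma R_instance: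
  "Act a (Act b x [+] z) [+] Act a (Act b y [+] w) \<approx>
    Act a (Act b x [+] Act b y [+] z) [+] Act a (Act b y [+] w)"
proof -
  have "(Act a (Act b (Var 0) [+] Var 2) [+] Act a (Act b (Var 1) [+] Var 3),
      Act a (Act b (Var 0) [+] Act b (Var 1) [+] Var 2) [+] Act a (Act b (Var 1) [+] Var 3)) \<in> Ax"
    using R by (auto simp: ax_R_def)
  from drv_axiom[OF this, of "subst4 x y z w"] show ?thesis by simp
qed

sublocale equational_RS
proof
  fix a b x y z
  \<comment> \<open>R is used with \<open>w\<close> chosen as \<open>b.x + z\<close>: the second
    prefix then coincides with the merged one, and the right-hand side collapses.\<close>
  have "Act a (Act b x [+] z) \<sqsubseteq> Act a (Act b x [+] z) [+] Act a (Act b y [+] (Act b x [+] z))"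
    by (rule below_Plus_left)
  also have "\<dots> \<sqsubseteq> Act a (Act b x [+] Act b y [+] z) [+] Act a (Act b y [+] (Act b x [+] z))"
    by (rule eqv_imp_below[OF R_instance])
  also have "\<dots> \<sqsubseteq> Act a (Act b x [+] Act b y [+] z)"
    by (intro Plus_belowI below_refl Act_mono_eqv below_antisym) (auto intro: below_PlusI1 below_PlusI2)
  finally show "Act a (Act b x [+] z) \<sqsubseteq> Act a (Act b x [+] Act b y [+] z)" .
qed

text \<open>The prefixes of \<open>y\<close> are added to \<open>p\<close> one at a time, with
  \<open>q\<close> fixed. Since \<open>p\<close> absorbs some \<open>b.x\<close> and
  \<open>q\<close> absorbs \<open>b.y\<close>, R read from right to left removes the addition; the
  initials of the growing \<open>p\<close> remain \<open>B\<close>.\<close>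

lemma merge_initials:
  assumes "basic q" "basic p" "basic y" "initials p = B"
    and "\<And>b y'. transition y b y' \<Longrightarrow> b \<in> B \<and> transition q b y'"
  shows "Act a (p [+] y) \<sqsubseteq> Act a p [+] Act a q"
  using assms(2-)
proof (induction y arbitrary: p)
  case Zero
  show ?case by (intro below_PlusI1 Act_mono_eqv A0)
next
  case (Act b y)
  then have "b \<in> initials p" and qy: "Act b y \<sqsubseteq> q"
    using Act_below_basic[OF assms(1)] by auto
  then obtain x where x: "Act b x \<sqsubseteq> p"
    using Act_below_basic[OF Act.prems(1)] by (auto simp: initials_def)
  have "Act a (p [+] Act b y) \<sqsubseteq> Act a (Act b x [+] Act b y [+] p)"
    by (intro Act_mono_eqv below_antisym Plus_belowI) (auto intro: below_PlusI1 below_PlusI2 x)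
  also have "\<dots> \<sqsubseteq> Act a (Act b x [+] Act b y [+] p) [+] Act a (Act b y [+] q)"
    by (rule below_Plus_left)
  also have "\<dots> \<sqsubseteq> Act a (Act b x [+] p) [+] Act a (Act b y [+] q)"
    by (rule eqv_imp_below[OF drv_sym[OF R_instance]])
  also have "\<dots> \<sqsubseteq> Act a p [+] Act a q"
    by (rule eqv_imp_below, intro drv_plus drv_act Plus_absorb x qy)
  finally show ?case .
next
  case (Plus y1 y2)
  have "Act a (p [+] (y1 [+] y2)) \<sqsubseteq> Act a (p [+] y1 [+] y2)"
    by (rule Act_mono_eqv[OF drv_sym[OF A2]])
  also have "\<dots> \<sqsubseteq> Act a (p [+] y1) [+] Act a q"
    using Plus.prems by (intro Plus.IH(2)) (auto simp: initials_def)
  also have "\<dots> \<sqsubseteq> Act a p [+] Act a q"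
    using Plus.prems by (intro Plus_belowI below_Plus_right Plus.IH(1)) auto
  finally show ?case .
qed auto

lemma complete_Readiness: "complete_axioms Ax (\<lambda>_ _. True) (=)"
proof unfold_locales
  show "Act a (p [+] restrict_initials B q) \<sqsubseteq> Act a p [+] Act a q"
    if "basic p" "basic q" "initials p = B" for p q B a
    using that
    by (intro merge_initials) (auto simp: basic_restrict_initials transition_restrict_initials)
qed auto

lemma complete_Failures:
  assumes F: "ax_F \<subseteq> Ax"
  shows "complete_axioms Ax (\<lambda>_ _. True) (\<subseteq>)"
proof unfold_locales
  fix p q :: "'a pterm" and B a
  assume q: "basic q"
  let ?y = "restrict_initials B q"
  have "(Act a (Var 0) [+] Act a (Var 1 [+] Var 2),
      Act a (Var 0) [+] Act a (Var 0 [+] Var 1) [+] Act a (Var 1 [+] Var 2)) \<in> Ax"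
    using F by (auto simp: ax_F_def)
  \<comment> \<open>F splits its second process as \<open>y + z\<close>. Taking the restriction for
    \<open>y\<close> and all of \<open>q\<close> for \<open>z\<close> works because \<open>q\<close>
    absorbs its restriction.\<close>
  from drv_axiom[OF this, of "subst4 p ?y q q"]
  have F_instance: "Act a p [+] Act a (?y [+] q) \<approx> Act a p [+] Act a (p [+] ?y) [+] Act a (?y [+] q)"
    by simp
  have y: "?y \<sqsubseteq> q"
    by (rule basic_below)
      (auto simp: q basic_restrict_initials transition_restrict_initials intro: Act_below_basic)
  have "Act a (p [+] ?y) \<sqsubseteq> Act a p [+] Act a (p [+] ?y) [+] Act a (?y [+] q)"
    by (intro below_PlusI1 below_Plus_right)
  also have "\<dots> \<sqsubseteq> Act a p [+] Act a (?y [+] q)"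
    by (rule eqv_imp_below[OF drv_sym[OF F_instance]])
  also have "\<dots> \<sqsubseteq> Act a p [+] Act a q"
    by (rule eqv_imp_below, intro drv_plus drv_refl drv_act Plus_absorb y)
  finally show "Act a (p [+] ?y) \<sqsubseteq> Act a p [+] Act a q" .
qed auto

end

section \<open>Failure traces\<close>

lemma (in equational) complete_Failure_Trace:
  assumes FT: "ax_FT \<subseteq> Ax" and RS: "ax_RS \<subseteq> Ax"
  shows "complete_axioms Ax (\<subseteq>) (\<subseteq>)"
proof unfold_locales
  fix a b :: 'a and x y z :: "'a pterm"
  have "(Act a (Act b (Var 0) [+] Act b (Var 1) [+] Var 2),
      Act a (Act b (Var 0) [+] Act b (Var 1) [+] Var 2) [+] Act a (Act b (Var 0) [+] Var 2)) \<in> Ax"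
    using RS by (auto simp: ax_RS_def)
  from drv_sym[OF drv_axiom[OF this, of "subst4 x y z z"]]
  show "Act a (Act b x [+] z) \<sqsubseteq> Act a (Act b x [+] Act b y [+] z)"
    unfolding below_def by simp
next
  fix p q :: "'a pterm" and B a
  assume q: "basic q" "initials q \<subseteq> B"
  have "(Act a (Var 0) [+] Act a (Var 1),
      Act a (Var 0) [+] Act a (Var 1) [+] Act a (Var 0 [+] Var 1)) \<in> Ax"
    using FT by (auto simp: ax_FT_def)
  \<comment> \<open>The initials of \<open>q\<close> lie in \<open>B\<close>, so the restriction is
    \<open>q\<close> itself and the merge is FT.\<close>
  from drv_sym[OF drv_axiom[OF this, of "subst4 p q q q"]]
  show "Act a (p [+] restrict_initials B q) \<sqsubseteq> Act a p [+] Act a q"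
    unfolding below_def restrict_initials_id[OF q] by simp
qed auto

section \<open>Ready traces: consequences of RT\<close>

locale equational_RT = equational Ax for Ax :: "('a::finite pterm \<times> 'a pterm) set" +
  assumes RT: "ax_RT \<subseteq> Ax"
begin

lemma RT_instance:
  "Act a (psum (map (\<lambda>i. Act (b i) (x i) [+] Act (b i) (y i)) [0..<card (UNIV :: 'a set)]) [+] z) \<approx>
   Act a (psum (map (\<lambda>i. Act (b i) (x i)) [0..<card (UNIV :: 'a set)]) [+] z) [+]
   Act a (psum (map (\<lambda>i. Act (b i) (y i)) [0..<card (UNIV :: 'a set)]) [+] z)"
proof -
  define \<sigma> where "\<sigma> n = (if n = 0 then z else if odd n then x (n div 2) else y (n div 2 - 1))" for n
  have \<sigma>: "\<sigma> 0 = z" "\<sigma> (Suc (2 * i)) = x i" "\<sigma> (Suc (Suc (2 * i))) = y i" for i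
    by (simp_all add: \<sigma>_def)
  have "(Act a (psum (map (\<lambda>i. Act (b i) (Var (2 * i + 1)) [+] Act (b i) (Var (2 * i + 2)))
        [0..<card (UNIV :: 'a set)]) [+] Var 0),
      Act a (psum (map (\<lambda>i. Act (b i) (Var (2 * i + 1))) [0..<card (UNIV :: 'a set)]) [+] Var 0) [+]
      Act a (psum (map (\<lambda>i. Act (b i) (Var (2 * i + 2))) [0..<card (UNIV :: 'a set)]) [+] Var 0)) \<in> Ax"
    using RT unfolding ax_RT_def by blast
  from drv_axiom[OF this, of \<sigma>] show ?thesis
    by (simp add: psubst_psum comp_def \<sigma>)
qed

text \<open>All \<open>b i\<close> are chosen equal, and idempotence collapses the sums; there is at
  least one copy because the set of actions is nonempty.\<close>

lemma RT_binary: "Act a (Act b x [+] Act b y [+] z) \<approx> Act a (Act b x [+] z) [+] Act a (Act b y [+] z)"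
proof -
  have const: "psum (map (\<lambda>i. t) [0..<card (UNIV :: 'a set)]) \<approx> t" for t :: "'a pterm"
  proof (rule below_antisym)
    show "t \<sqsubseteq> psum (map (\<lambda>i. t) [0..<card (UNIV :: 'a set)])"
      by (rule below_psum) (auto simp: image_iff card_gt_0_iff intro: exI[of _ 0])
  qed (rule psum_below, auto)
  have "Act a (Act b x [+] Act b y [+] z) \<approx>
      Act a (psum (map (\<lambda>i. Act b x [+] Act b y) [0..<card (UNIV :: 'a set)]) [+] z)"
    by (intro drv_act drv_plus drv_refl drv_sym[OF const])
  also have "\<dots> \<approx> Act a (psum (map (\<lambda>i. Act b x) [0..<card (UNIV :: 'a set)]) [+] z) [+]
      Act a (psum (map (\<lambda>i. Act b y) [0..<card (UNIV :: 'a set)]) [+] z)"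
    by (rule RT_instance)
  also have "\<dots> \<approx> Act a (Act b x [+] z) [+] Act a (Act b y [+] z)"
    by (intro drv_act drv_plus drv_refl const)
  finally show ?thesis .
qed

sublocale equational_RS
proof
  show "Act a (Act b x [+] z) \<sqsubseteq> Act a (Act b x [+] Act b y [+] z)" for a b x y z
    by (rule below_trans[OF below_Plus_left eqv_imp_below[OF drv_sym[OF RT_binary]]])
qed

text \<open>
  A choice \<open>r\<close> of one derivative per action is a mixture of a choice \<open>f\<close> from \<open>p\<close> and a choice \<open>g\<close>
  from \<open>q\<close>, which RT can combine. The enumeration \<open>b\<close> of \<open>B\<close> repeats an element to reach the length
  \<open>|\<A>|\<close> prescribed by RT.
\<close>

lemma merge_functional:
  assumes "basic p" "basic q" "initials p = B" "initials q = B"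
    and r: "\<And>c. c \<in> B \<Longrightarrow> transition p c (r c) \<or> transition q c (r c)"
    and l: "set l = (\<lambda>c. (c, r c)) ` B"
  shows "Act a (psum (summands l)) \<sqsubseteq> Act a p [+] Act a q"
proof (cases "B = {}")
  case True
  \<comment> \<open>Without initials there is no action to enumerate, and \<open>p\<close> is equal
    to \<open>Zero\<close>.\<close>
  then have "p \<sqsubseteq> Zero"
    by (intro basic_below[OF assms(1)]) (use assms(3) in \<open>auto simp: initials_def\<close>)
  then have "Act a Zero \<sqsubseteq> Act a p" by (intro Act_mono_eqv below_antisym) auto
  then show ?thesis using True l by (auto simp: summands_def intro: below_PlusI1)
next
  case False
  let ?n = "card (UNIV :: 'a set)"
  obtain h where h: "bij_betw h {0..<card B} B"
    using ex_bij_betw_nat_finite[of B] by auto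
  have cardB: "0 < card B" "card B \<le> ?n"
    using False by (auto simp: card_gt_0_iff intro: card_mono)
  define b where "b i = (if i < card B then h i else h 0)" for i
  have b_in: "b i \<in> B" for i
    using bij_betwE[OF h] cardB by (auto simp: b_def)
  have b_surj: "\<exists>i<?n. c = b i" if "c \<in> B" for c
  proof -
    have "c \<in> h ` {0..<card B}"
      using that bij_betw_imp_surj_on[OF h] by simp
    then obtain i where "i < card B" "c = h i" by auto
    then show ?thesis using cardB by (intro exI[of _ i]) (auto simp: b_def)
  qed
  \<comment> \<open>\<open>f\<close> follows \<open>r\<close> wherever \<open>p\<close> offers that
    derivative and otherwise takes any \<open>c\<close>-derivative of \<open>p\<close>, which exists
    since \<open>c\<close> is initial.\<close>
  have "\<exists>x. transition p c x \<and> (transition p c (r c) \<longrightarrow> x = r c)" if "c \<in> B" for c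
    using that assms(3) by (cases "transition p c (r c)") (auto simp: initials_def)
  then obtain f where f: "\<And>c. c \<in> B \<Longrightarrow> transition p c (f c) \<and> (transition p c (r c) \<longrightarrow> f c = r c)"
    by metis
  have "\<exists>x. transition q c x \<and> (transition q c (r c) \<longrightarrow> x = r c)" if "c \<in> B" for c
    using that assms(4) by (cases "transition q c (r c)") (auto simp: initials_def)
  then obtain g where g: "\<And>c. c \<in> B \<Longrightarrow> transition q c (g c) \<and> (transition q c (r c) \<longrightarrow> g c = r c)"
    by metis
  let ?w = "psum (map (\<lambda>i. Act (b i) (f (b i)) [+] Act (b i) (g (b i))) [0..<?n]) [+] Zero"
  let ?p = "psum (map (\<lambda>i. Act (b i) (f (b i))) [0..<?n]) [+] Zero"
  let ?q = "psum (map (\<lambda>i. Act (b i) (g (b i))) [0..<?n]) [+] Zero"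
  have bf: "basic (f c)" "basic (g c)" if "c \<in> B" for c
    using f[OF that] g[OF that] basic_transition[OF assms(1), of c "f c"]
      basic_transition[OF assms(2), of c "g c"] by simp_all
  have br: "basic (r c)" if "c \<in> B" for c
    using r[OF that] basic_transition[OF assms(1), of c "r c"]
      basic_transition[OF assms(2), of c "r c"] by blast
  have Ib: "(\<Union>i\<in>{0..<?n}. {b i}) = B"
    using b_in b_surj by fastforce
  have basics: "basic ?w" "basic ?p" "basic ?q" "basic (psum (summands l))"
    using bf b_in br by (auto simp: basic_psum set_summands l)
  have I: "initials ?w = B" "initials ?p = B" "initials ?q = B"
    using Ib by (auto simp: initials_psum)
  have Il: "initials (psum (summands l)) = B"
    by (simp add: initials_summands l image_image)
  have "psum (summands l) \<sqsubseteq> ?w"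
  proof (rule summands_below)
    fix c t
    assume "(c, t) \<in> set l"
    then have c: "c \<in> B" "t = r c" using l by auto
    then obtain i where i: "i < ?n" "c = b i" using b_surj by blast
    have "Act c t \<sqsubseteq> Act (b i) (f (b i)) [+] Act (b i) (g (b i))"
      using r[OF c(1)] f[OF c(1)] g[OF c(1)] c i by (auto intro: below_PlusI1 below_PlusI2)
    also have "\<dots> \<sqsubseteq> ?w"
      using i by (intro below_PlusI1 below_psum) auto
    finally show "Act c t \<sqsubseteq> ?w" .
  qed
  then have "Act a (psum (summands l)) \<sqsubseteq> Act a ?w"
    using basics I Il by (intro Act_mono_below) auto
  also have "\<dots> \<sqsubseteq> Act a ?p [+] Act a ?q"
    by (rule eqv_imp_below[OF RT_instance])
  also have "\<dots> \<sqsubseteq> Act a p [+] Act a q"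
  proof (intro Plus_belowI)
    \<comment> \<open>The chosen summands of \<open>p\<close> still cover all of \<open>B\<close>,
      as monotonicity under the prefix demands.\<close>
    have "?p \<sqsubseteq> p"
      using Act_below_basic[OF assms(1)] f b_in by (intro Plus_belowI psum_below) auto
    then show "Act a ?p \<sqsubseteq> Act a p [+] Act a q"
      using basics I assms by (intro below_PlusI1 Act_mono_below) auto
    have "?q \<sqsubseteq> q"
      using Act_below_basic[OF assms(2)] g b_in by (intro Plus_belowI psum_below) auto
    then show "Act a ?q \<sqsubseteq> Act a p [+] Act a q"
      using basics I assms by (intro below_PlusI2 Act_mono_below) auto
  qed
  finally show ?thesis .
qed

text \<open>As long as some action has two derivatives in \<open>l\<close>, \<open>RT_binary\<close>
  splits the sum into two shorter ones that still cover \<open>B\<close>. What remains at the end is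
  one derivative per action, the case of \<open>merge_functional\<close>.\<close>

lemma merge_summands:
  assumes "basic p" "basic q" "initials p = B" "initials q = B"
    and "\<forall>(b, t)\<in>set l. transition p b t \<or> transition q b t" "fst ` set l = B"
  shows "Act a (psum (summands l)) \<sqsubseteq> Act a p [+] Act a q"
  using assms(5,6)
proof (induction "length l" arbitrary: l rule: less_induct)
  case less
  show ?case
  proof (cases "\<exists>b x y. (b, x) \<in> set l \<and> (b, y) \<in> set l \<and> x \<noteq> y")
    case True
    then obtain b x y where *: "(b, x) \<in> set l" "(b, y) \<in> set l" "x \<noteq> y" by blast
    let ?z = "psum (summands (removeAll (b, x) (removeAll (b, y) l)))"
    \<comment> \<open>After \<open>(b, v)\<close> is removed, \<open>(b, u)\<close> still witnesses
      the action \<open>b\<close>, so \<open>B\<close> stays covered.\<close>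
    have IH: "Act a (psum (summands (removeAll (b, v) l))) \<sqsubseteq> Act a p [+] Act a q"
      if "(b, u) \<in> set l" "(b, v) \<in> set l" "u \<noteq> v" for u v
    proof (rule less.hyps)
      show "length (removeAll (b, v) l) < length l"
        using that(2) by (rule length_removeAll_less)
      have "c \<in> fst ` set (removeAll (b, v) l)" if c: "(c, t) \<in> set l" for c t
      proof (cases "(c, t) = (b, v)")
        case True
        then have "(c, u) \<in> set (removeAll (b, v) l)"
          using \<open>(b, u) \<in> set l\<close> \<open>u \<noteq> v\<close> by auto
        then show ?thesis by force
      next
        case False
        then have "(c, t) \<in> set (removeAll (b, v) l)" using c by auto
        then show ?thesis by force
      qed
      then have "fst ` set (removeAll (b, v) l) = fst ` set l" by force
      with less.prems(2) show "fst ` set (removeAll (b, v) l) = B" by simp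
    qed (use less.prems(1) in auto)
    have "Act a (psum (summands l)) \<sqsubseteq> Act a (Act b x [+] Act b y [+] ?z)"
    proof (intro Act_mono_eqv below_antisym)
      show "psum (summands l) \<sqsubseteq> Act b x [+] Act b y [+] ?z"
      proof (rule summands_below)
        fix c t
        assume "(c, t) \<in> set l"
        then consider "(c, t) = (b, x)" | "(c, t) = (b, y)"
          | "(c, t) \<in> set (removeAll (b, x) (removeAll (b, y) l))" by auto
        then show "Act c t \<sqsubseteq> Act b x [+] Act b y [+] ?z"
          by cases (auto intro: below_PlusI1 below_PlusI2 below_PlusI2[OF Act_below_summands])
      qed
      show "Act b x [+] Act b y [+] ?z \<sqsubseteq> psum (summands l)"
        using * by (intro Plus_belowI summands_below) (auto intro: Act_below_summands)
    qed
    also have "\<dots> \<sqsubseteq> Act a (Act b x [+] ?z) [+] Act a (Act b y [+] ?z)"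
      by (rule eqv_imp_below[OF RT_binary])
    also have "\<dots> \<sqsubseteq> Act a (psum (summands (removeAll (b, y) l))) [+] Act a (psum (summands (removeAll (b, x) l)))"
    proof (rule eqv_imp_below, rule drv_plus[OF drv_act[OF below_antisym] drv_act[OF below_antisym]])
      show "Act b x [+] ?z \<sqsubseteq> psum (summands (removeAll (b, y) l))"
        "Act b y [+] ?z \<sqsubseteq> psum (summands (removeAll (b, x) l))"
        using * by (auto intro!: Plus_belowI summands_below intro: Act_below_summands)
      show "psum (summands (removeAll (b, y) l)) \<sqsubseteq> Act b x [+] ?z"
      proof (rule summands_below)
        fix c t
        assume "(c, t) \<in> set (removeAll (b, y) l)"
        then show "Act c t \<sqsubseteq> Act b x [+] ?z"
          by (cases "(c, t) = (b, x)") (auto intro: below_PlusI1 below_PlusI2[OF Act_below_summands])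
      qed
      show "psum (summands (removeAll (b, x) l)) \<sqsubseteq> Act b y [+] ?z"
      proof (rule summands_below)
        fix c t
        assume "(c, t) \<in> set (removeAll (b, x) l)"
        then show "Act c t \<sqsubseteq> Act b y [+] ?z"
          by (cases "(c, t) = (b, y)") (auto intro: below_PlusI1 below_PlusI2[OF Act_below_summands])
      qed
    qed
    also have "\<dots> \<sqsubseteq> Act a p [+] Act a q"
      using IH * by (intro Plus_belowI) auto
    finally show ?thesis .
  next
    case False
    have "\<exists>t. (c, t) \<in> set l" if "c \<in> B" for c
      using that less.prems(2) by force
    then obtain r where r: "\<And>c. c \<in> B \<Longrightarrow> (c, r c) \<in> set l" by metis
    have l: "set l = (\<lambda>c. (c, r c)) ` B"
    proof (intro equalityI subsetI)
      fix x
      assume x: "x \<in> set l"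
      then have "fst x \<in> B" using less.prems(2) by blast
      moreover from this have "x = (fst x, r (fst x))"
        using False x r by (metis prod.collapse)
      ultimately show "x \<in> (\<lambda>c. (c, r c)) ` B" by blast
    qed (use r in auto)
    show ?thesis
      using r less.prems(1) by (intro merge_functional[OF assms(1-4) _ l]) auto
  qed
qed

lemma complete_Ready_Trace: "complete_axioms Ax (=) (=)"
proof unfold_locales
  fix p q :: "'a pterm" and B a
  assume pq: "basic p" "basic q" "initials p = B" "initials q = B"
  obtain l where l: "p [+] q \<approx> psum (summands l)" "set l = {(a, u). transition (p [+] q) a u}"
    using head_normal_form[of "p [+] q"] pq by auto
  have "fst ` set l = initials (p [+] q)"
    unfolding l(2) initials_def by force
  then have "Act a (psum (summands l)) \<sqsubseteq> Act a p [+] Act a q"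
    using pq l(2) by (intro merge_summands) auto
  then have "Act a (p [+] q) \<sqsubseteq> Act a p [+] Act a q"
    by (rule below_trans[OF Act_mono_eqv[OF l(1)]])
  then show "Act a (p [+] restrict_initials B q) \<sqsubseteq> Act a p [+] Act a q"
    using pq by (simp add: restrict_initials_id)
qed auto

end

lemma complete_axioms_of: "complete_axioms (axioms_of X) (mid_rel X) (end_rel X)"
proof (cases X)
  case Ready_Trace
  then interpret equational_RT "axioms_of X" by unfold_locales auto
  show ?thesis using Ready_Trace complete_Ready_Trace by simp
next
  case Failure_Trace
  then interpret equational "axioms_of X" by unfold_locales auto
  show ?thesis using Failure_Trace complete_Failure_Trace by auto
next
  case Readiness
  then interpret equational_R "axioms_of X" by unfold_locales auto
  show ?thesis using Readiness complete_Readiness by simp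
next
  case Failures
  then interpret equational_R "axioms_of X" by unfold_locales auto
  show ?thesis using Failures complete_Failures by auto
qed

theorem theorem5p7:
  fixes X :: semantics and p q :: "'a::finite pterm"
  assumes "closed_term p" and "closed_term q"
  shows "sem_equiv X p q \<longleftrightarrow> axioms_of X \<turnstile> p \<approx> q"
proof
  assume eq: "sem_equiv X p q"
  interpret complete_axioms "axioms_of X" "mid_rel X" "end_rel X" by (rule complete_axioms_of)
  obtain r s where r: "basic r" "axioms_of X \<turnstile> p \<approx> r"
    and s: "basic s" "axioms_of X \<turnstile> q \<approx> s"
    using assms basic_representative by meson
  \<comment> \<open>Soundness carries the equivalence over to the basic representatives.\<close>
  have "sem_equiv X r s"
    using eq derivable_imp_sem_equiv[OF r(2)] derivable_imp_sem_equiv[OF s(2)]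
    by (simp add: sem_equiv_iff_obs)
  then have "axioms_of X \<turnstile> r \<approx> s"
    using r(1) s(1) by (intro completeness_basic) (simp_all add: sem_equiv_iff_obs)
  then show "axioms_of X \<turnstile> p \<approx> q"
    by (rule drv_trans[OF r(2) drv_trans[OF _ drv_sym[OF s(2)]]])
qed (rule derivable_imp_sem_equiv)

end
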